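(* Let $n\ge 2$ be even and let $\mathbb F$ be an algebraically closed field of characteristic not $2$. Let $\Gamma_{C;n}$ be the path with vertices $1,\dots,n$ and edges $\{i,i+1\}$, $1\le i\le n-1$. Let $\mathcal L=\langle x_1,\dots,x_n\rangle_{\mathrm{Lie}}$ be any Lie algebra over $\mathbb F$ whose generators $x_1,\dots,x_n$ realize $\Gamma_{C;n}$, and suppose that $f(x_i,x_{i+1})\ne 0$ for all $1\le i\le n-1$. Then $\mathcal L$ is isomorphic to $\mathfrak{sp}_n$.
   Context: A nonzero element $x$ of a Lie algebra $\mathcal L$ is extremal if $[x,[x,\mathcal L]]\subseteq\mathbb Fx$; for extremal $x$ and $y\in\mathcal L$, $f(x,y)\in\mathbb F$ is defined by $[x,[x,y]]=f(x,y)x$. Elements $x_1,\dots,x_n$ of a Lie algebra realize a graph $\Gamma$ on $\{1,\dots,n\}$ if each $x_i$ is an extremal element of the Lie algebra $\langle x_1,\dots,x_n\rangle_{\mathrm{Lie}}$ they generate and, for $i\neq j$, the vertices $i,j$ are adjacent if and only if $[x_i,x_j]\ne0$. $\mathfrak{sp}_n$ ($n$ even) is the Lie algebra of linear endomorphisms of $\mathbb F^n$ that are skew with respect to a nondegenerate alternating bilinear form. *)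

theory Defs
  imports
    "HOL-Computational_Algebra.Computational_Algebra"
    "Jordan_Normal_Form.Matrix"
begin

locale lie_algebra = vector_space scale
  for scale :: "'k::field \<Rightarrow> 'l::ab_group_add \<Rightarrow> 'l" (infixr \<open>*\<^sub>L\<close> 75) +
  fixes bracket :: "'l \<Rightarrow> 'l \<Rightarrow> 'l"
  assumes bracket_add_left: "bracket (x + y) z = bracket x z + bracket y z"
    and bracket_add_right: "bracket x (y + z) = bracket x y + bracket x z"
    and bracket_scale_left: "bracket (c *\<^sub>L x) y = c *\<^sub>L bracket x y"
    and bracket_scale_right: "bracket x (c *\<^sub>L y) = c *\<^sub>L bracket x y"
    and bracket_self: "bracket x x = 0"
    and jacobi: "bracket x (bracket y z) + bracket y (bracket z x) + bracket z (bracket x y) = 0"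
begin

definition lie_subalgebra :: "'l set \<Rightarrow> bool" where
  "lie_subalgebra M \<longleftrightarrow> subspace M \<and> (\<forall>x\<in>M. \<forall>y\<in>M. bracket x y \<in> M)"

definition lie_span :: "'l set \<Rightarrow> 'l set" where
  "lie_span S = lie_subalgebra hull S"

definition extremal_in :: "'l set \<Rightarrow> 'l \<Rightarrow> bool" where
  "extremal_in M x \<longleftrightarrow>
     x \<in> M \<and> x \<noteq> 0 \<and> (\<forall>y\<in>M. \<exists>c. bracket x (bracket x y) = c *\<^sub>L x)"

text \<open>The following scalar is only meaningful when \<open>x\<close> is extremal in a subalgebra
  containing \<open>y\<close>; it is then uniquely determined because \<open>x \<noteq> 0\<close>.\<close>

definition extremal_form :: "'l \<Rightarrow> 'l \<Rightarrow> 'k" where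
  "extremal_form x y = (THE c. bracket x (bracket x y) = c *\<^sub>L x)"

text \<open>\<open>E\<close> is the edge set of a graph on \<open>{1..n}\<close>, each edge being a two-element set of
  vertices. Extremality is relative to the subalgebra generated by the \<open>x i\<close>, not to the
  ambient Lie algebra.\<close>

definition realizes :: "nat \<Rightarrow> nat set set \<Rightarrow> (nat \<Rightarrow> 'l) \<Rightarrow> bool" where
  "realizes n E x \<longleftrightarrow>
     (\<forall>i\<in>{1..n}. extremal_in (lie_span (x ` {1..n})) (x i)) \<and>
     (\<forall>i\<in>{1..n}. \<forall>j\<in>{1..n}. i \<noteq> j \<longrightarrow> ({i, j} \<in> E \<longleftrightarrow> bracket (x i) (x j) \<noteq> 0))"

text \<open>Isomorphism of a Lie subalgebra \<open>M\<close> with a Lie algebra \<open>S\<close> of square matrices under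
  the commutator bracket. The matrix type has no global vector space structure, so
  linearity is spelled out.\<close>

definition isomorphic_to_matrix_lie_algebra :: "'l set \<Rightarrow> 'k mat set \<Rightarrow> bool" where
  "isomorphic_to_matrix_lie_algebra M S \<longleftrightarrow>
     (\<exists>\<phi>. bij_betw \<phi> M S \<and>
        (\<forall>x\<in>M. \<forall>y\<in>M. \<phi> (x + y) = \<phi> x + \<phi> y) \<and>
        (\<forall>c. \<forall>x\<in>M. \<phi> (c *\<^sub>L x) = c \<cdot>\<^sub>m \<phi> x) \<and>
        (\<forall>x\<in>M. \<forall>y\<in>M. \<phi> (bracket x y) = \<phi> x * \<phi> y - \<phi> y * \<phi> x))"

end

definition path_edges :: "nat \<Rightarrow> nat set set" where
  "path_edges n = {{i, i + 1} | i. 1 \<le> i \<and> i < n}"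

definition bilinear_form :: "nat \<Rightarrow> ('k::field vec \<Rightarrow> 'k vec \<Rightarrow> 'k) \<Rightarrow> bool" where
  "bilinear_form n B \<longleftrightarrow>
     (\<forall>u\<in>carrier_vec n. \<forall>v\<in>carrier_vec n. \<forall>w\<in>carrier_vec n.
        B (u + v) w = B u w + B v w \<and> B u (v + w) = B u v + B u w) \<and>
     (\<forall>c. \<forall>u\<in>carrier_vec n. \<forall>v\<in>carrier_vec n.
        B (c \<cdot>\<^sub>v u) v = c * B u v \<and> B u (c \<cdot>\<^sub>v v) = c * B u v)"

definition alternating_form :: "nat \<Rightarrow> ('k::field vec \<Rightarrow> 'k vec \<Rightarrow> 'k) \<Rightarrow> bool" where
  "alternating_form n B \<longleftrightarrow> bilinear_form n B \<and> (\<forall>v\<in>carrier_vec n. B v v = 0)"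

definition nondegenerate_form :: "nat \<Rightarrow> ('k::field vec \<Rightarrow> 'k vec \<Rightarrow> 'k) \<Rightarrow> bool" where
  "nondegenerate_form n B \<longleftrightarrow>
     (\<forall>v\<in>carrier_vec n. (\<forall>w\<in>carrier_vec n. B v w = 0) \<longrightarrow> v = 0\<^sub>v n)"

text \<open>Endomorphisms of the space of column vectors of length \<open>n\<close> are represented by their
  matrices with respect to the standard basis.\<close>

definition sp :: "nat \<Rightarrow> ('k::field vec \<Rightarrow> 'k vec \<Rightarrow> 'k) \<Rightarrow> 'k mat set" where
  "sp n B = {A \<in> carrier_mat n n.
     \<forall>v\<in>carrier_vec n. \<forall>w\<in>carrier_vec n. B (A *\<^sub>v v) w = - B v (A *\<^sub>v w)}"

text \<open>Nondegenerate alternating forms exist in every even dimension, so statements about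
  \<open>sp n B\<close> for all such \<open>B\<close> are not vacuous.\<close>

lemma ex_nondegenerate_alternating_form:
  assumes "even n"
  shows "\<exists>B :: 'k::field vec \<Rightarrow> 'k vec \<Rightarrow> 'k. alternating_form n B \<and> nondegenerate_form n B"
proof -
  define B :: "'k vec \<Rightarrow> 'k vec \<Rightarrow> 'k" where
    "B v w = (\<Sum>i<n div 2. v $ (2*i) * w $ (2*i+1) - v $ (2*i+1) * w $ (2*i))" for v w
  have lt: "2*i < n" "2*i+1 < n" if "i < n div 2" for i
    using that assms by auto
  have parity: "2*i \<noteq> 2*j+1" "2*i+1 \<noteq> 2*j" for i j :: nat
    by presburger+
  have "alternating_form n B"
    unfolding alternating_form_def bilinear_form_def B_def
    using lt by (auto simp: sum.distrib[symmetric] sum_distrib_left algebra_simps intro!: sum.cong sum.neutral)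
  moreover have "nondegenerate_form n B"
    unfolding nondegenerate_form_def
  proof (intro ballI impI)
    fix v assume v: "v \<in> carrier_vec n" and 0: "\<forall>w\<in>carrier_vec n. B v w = 0"
    have "v $ (2*j) = 0 \<and> v $ (2*j+1) = 0" if j: "j < n div 2" for j
    proof
      have "B v (unit_vec n (2*j+1)) = (\<Sum>i<n div 2. if i = j then v $ (2*j) else 0)"
        unfolding B_def using lt j parity by (intro sum.cong refl) (simp add: unit_vec_def)
      then show "v $ (2*j) = 0" using 0 j by simp
      have "B v (unit_vec n (2*j)) = (\<Sum>i<n div 2. if i = j then - v $ (2*j+1) else 0)"
        unfolding B_def using lt j parity by (intro sum.cong refl) (simp add: unit_vec_def)
      then show "v $ (2*j+1) = 0" using 0 j by simp
    qed
    then have "v $ k = 0" if "k < n" for k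
    proof -
      have "k div 2 < n div 2" using that assms by presburger
      moreover have "k = 2 * (k div 2) \<or> k = 2 * (k div 2) + 1" by presburger
      ultimately show ?thesis
        using \<open>\<And>j. j < n div 2 \<Longrightarrow> v $ (2*j) = 0 \<and> v $ (2*j+1) = 0\<close> by metis
    qed
    then show "v = 0\<^sub>v n" using v by auto
  qed
  ultimately show ?thesis by blast
qed

end

(* After rescaling the generators, [x_i, [x_i, x_j]] = 2 x_i whenever i and j are adjacent. The
   elements y i j = [x_i, [x_(i+1), ..., x_j]] (i < j) and y i i = 2 x_i then satisfy
   [x_k, y i j] = c k i y k j + c k j y k i, where c is the alternating form of the path; only
   Premet's identity for commuting arguments is needed. These are the relations between the
   products v_i v_j in the symmetric square of a space with basis v_1, ..., v_n and Gram matrix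
   c. As symmetric matrices S with the bracket S c T - T c S are generated by the diagonal matrix
   units, S |-> sum S_ij/2 y i j is a surjective Lie homomorphism onto L. For S in its kernel put
   D = c S c: bracketing twice with v_k^2 gives D_kk x_k = 0, and using this for all brackets of
   S as well gives D = 0, whence S = 0 because c is nonsingular for even n. Finally, every
   nondegenerate alternating form on an n-dimensional space has Gram matrix c in some basis. *)
theory Submission
  imports Defs "Jordan_Normal_Form.Determinant"
begin


subsection \<open>Extremal elements\<close>

text \<open>No module for L is given, so there is no direct way to write elements of L as matrices;
  the comparison map therefore runs from the model onto L. Surjectivity only bounds L from above.
  The bound from below rests on each \<open>x k\<close> being nonzero, which is why elements of the
  kernel are tested through the scalars they produce in front of \<open>x k\<close>. The symmetric
  square is the right model because contraction with an alternating form turns symmetric tensors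
  into skew endomorphisms: the product v_i v_j acts by w |-> c(v_j, w) v_i + c(v_i, w) v_j. Thus
  v_i^2/2 is the map w |-> c(v_i, w) v_i, and bracketing twice with it sends v_(i+1)^2/2 to twice
  v_i^2/2; this is the value 2 at which the rescaling aims.\<close>

context lie_algebra
begin

lemma bracket_zero_left [simp]: "bracket 0 y = 0"
  using bracket_add_left[of 0 0 y] by simp

lemma bracket_zero_right [simp]: "bracket y 0 = 0"
  using bracket_add_right[of y 0 0] by simp

lemma bracket_anticomm: "bracket y x = - bracket x y"
proof -
  have "0 = bracket (x + y) (x + y)" by (simp add: bracket_self)
  also have "\<dots> = bracket x y + bracket y x"
    unfolding bracket_add_left bracket_add_right by (simp add: bracket_self)
  finally show ?thesis by (metis minus_unique)
qed

lemma bracket_minus_right: "bracket x (- y) = - bracket x y"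
  using bracket_add_right[of x y "- y"] by (simp add: minus_unique)

lemma bracket_derivation: "bracket x (bracket y z) = bracket (bracket x y) z + bracket y (bracket x z)"
proof -
  have "bracket x (bracket y z) + - bracket y (bracket x z) + - bracket (bracket x y) z = 0"
    using jacobi[of x y z]
    by (simp only: bracket_anticomm[of z x] bracket_minus_right bracket_anticomm[of z "bracket x y"])
  then show ?thesis by (simp add: algebra_simps)
qed

lemma lie_subalgebra_lie_span: "lie_subalgebra (lie_span S)"
proof -
  have "lie_subalgebra (\<Inter>T)" if "Ball T lie_subalgebra" for T
    using that by (auto simp: lie_subalgebra_def subspace_def)
  then show ?thesis unfolding lie_span_def by (rule hull_in)
qed

lemma lie_span_superset: "S \<subseteq> lie_span S"
  unfolding lie_span_def by (rule hull_subset)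

lemma lie_span_minimal: "S \<subseteq> M \<Longrightarrow> lie_subalgebra M \<Longrightarrow> lie_span S \<subseteq> M"
  unfolding lie_span_def by (rule hull_minimal)

lemma bracket_in_lie_span: "u \<in> lie_span S \<Longrightarrow> v \<in> lie_span S \<Longrightarrow> bracket u v \<in> lie_span S"
  using lie_subalgebra_lie_span[of S] by (auto simp: lie_subalgebra_def)

lemma subspace_lie_span: "subspace (lie_span S)"
  using lie_subalgebra_lie_span[of S] by (auto simp: lie_subalgebra_def)

lemma lie_span_rescale:
  assumes "\<And>i. i \<in> I \<Longrightarrow> a i \<noteq> 0"
  shows "lie_span ((\<lambda>i. a i *\<^sub>L x i) ` I) = lie_span (x ` I)"
proof (intro subset_antisym lie_span_minimal lie_subalgebra_lie_span)
  show "(\<lambda>i. a i *\<^sub>L x i) ` I \<subseteq> lie_span (x ` I)"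
    using lie_span_superset[of "x ` I"] subspace_scale[OF subspace_lie_span] by fastforce
  show "x ` I \<subseteq> lie_span ((\<lambda>i. a i *\<^sub>L x i) ` I)"
  proof clarify
    fix i assume i: "i \<in> I"
    let ?S = "(\<lambda>i. a i *\<^sub>L x i) ` I"
    have "a i *\<^sub>L x i \<in> lie_span ?S" using lie_span_superset[of ?S] i by blast
    then have "inverse (a i) *\<^sub>L a i *\<^sub>L x i \<in> lie_span ?S"
      by (rule subspace_scale[OF subspace_lie_span])
    then show "x i \<in> lie_span ?S" using assms[OF i] by simp
  qed
qed

lemma extremal_form_eq:
  assumes "extremal_in M x" "y \<in> M"
  shows "bracket x (bracket x y) = extremal_form x y *\<^sub>L x"
proof -
  obtain c where c: "bracket x (bracket x y) = c *\<^sub>L x" and "x \<noteq> 0"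
    using assms unfolding extremal_in_def by blast
  then have "\<exists>!c. bracket x (bracket x y) = c *\<^sub>L x" by auto
  then show ?thesis unfolding extremal_form_def by (rule theI')
qed

text \<open>The Jacobi identity for \<open>x\<close>, \<open>y\<close>, \<open>bracket x y\<close> reads \<open>(f x y - f y x) *\<^sub>L bracket x y = 0\<close>.\<close>

lemma extremal_form_commute:
  assumes "extremal_in M x" "extremal_in M y" "bracket x y \<noteq> 0"
  shows "extremal_form x y = extremal_form y x"
proof -
  let ?f = "extremal_form x y" and ?g = "extremal_form y x" and ?z = "bracket x y"
  have "x \<in> M" "y \<in> M" using assms by (auto simp: extremal_in_def)
  then have x: "bracket x ?z = ?f *\<^sub>L x" and y: "bracket y (bracket y x) = ?g *\<^sub>L y"
    using assms extremal_form_eq by auto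
  have y': "bracket y ?z = - (?g *\<^sub>L y)"
    using y by (simp add: bracket_anticomm[of y x] bracket_minus_right minus_equation_iff[of _ "?g *\<^sub>L y"])
  have "bracket x (bracket y ?z) = bracket y (bracket x ?z)"
    using bracket_derivation[of x y ?z] by (simp add: bracket_self)
  then have "?g *\<^sub>L ?z = ?f *\<^sub>L ?z"
    by (simp add: x y' bracket_minus_right bracket_scale_right bracket_anticomm[of y x])
  then show ?thesis using assms(3) by simp
qed

text \<open>Expand (ad x)^2 [p, q] = 0 by the Leibniz rule: the middle term is 2 [[x, p], [x, q]],
  and [x, [p, [x, q]]] differs from [[x, p], [x, q]] by a multiple of [x, p]. The term f(x, [p, q])
  x of Premet's general identity vanishes here.\<close>

lemma premet_commuting:
  assumes "bracket p q = 0" "bracket x (bracket x p) = f *\<^sub>L x" "bracket x (bracket x q) = g *\<^sub>L x"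
  shows "2 *\<^sub>L bracket x (bracket p (bracket x q)) = - (f *\<^sub>L bracket x q) - g *\<^sub>L bracket x p"
proof -
  let ?A = "bracket (bracket x p) (bracket x q)"
  have two: "2 *\<^sub>L v = v + v" for v
    using scale_left_distrib[of 1 1 v] by simp
  have a: "bracket x (bracket p (bracket x q)) = bracket (bracket x p) (bracket x q) - g *\<^sub>L bracket x p"
    using bracket_derivation[of x p "bracket x q"] assms(3)
    by (simp add: bracket_scale_right bracket_anticomm[of p x])
  have "0 = bracket x (bracket x (bracket p q))" using assms(1) by simp
  also have "\<dots> = f *\<^sub>L bracket x q + bracket (bracket x p) (bracket x q)
      + (bracket (bracket x p) (bracket x q) - g *\<^sub>L bracket x p)"
    unfolding bracket_derivation[of x p q] bracket_add_right
      bracket_derivation[of x "bracket x p" q] bracket_derivation[of x p "bracket x q"] assms(2,3)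
    by (simp add: bracket_scale_left bracket_scale_right bracket_anticomm[of p x])
  finally have 0: "f *\<^sub>L bracket x q + ?A + (?A - g *\<^sub>L bracket x p) = 0" by (rule sym)
  have "?A + ?A = f *\<^sub>L bracket x q + ?A + (?A - g *\<^sub>L bracket x p)
      + (g *\<^sub>L bracket x p - f *\<^sub>L bracket x q)"
    by (simp add: algebra_simps)
  then have "?A + ?A = g *\<^sub>L bracket x p - f *\<^sub>L bracket x q"
    unfolding 0 by simp
  then show ?thesis unfolding a two by (simp add: algebra_simps)
qed

end

subsection \<open>Lie algebras generated along a path\<close>

definition path_form :: "nat \<Rightarrow> nat \<Rightarrow> 'k::ring_1" where
  "path_form i j = (if j = Suc i then 1 else if i = Suc j then -1 else 0)"

lemma path_form_simps [simp]:
  "path_form i i = 0" "path_form i (Suc i) = 1" "path_form (Suc i) i = -1"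
  by (auto simp: path_form_def)

lemma path_form_skew: "path_form j i = - path_form i j"
  by (auto simp: path_form_def)

text \<open>The generators after rescaling, indexed from 0 to agree with matrix entries. Extremality
  enters through its values on neighbouring generators; parity of \<open>n\<close> is left
  open.\<close>

locale path_generators = lie_algebra scale bracket
  for scale :: "'k::field \<Rightarrow> 'l::ab_group_add \<Rightarrow> 'l" (infixr \<open>*\<^sub>L\<close> 75)
    and bracket :: "'l \<Rightarrow> 'l \<Rightarrow> 'l" +
  fixes n :: nat and x :: "nat \<Rightarrow> 'l"
  assumes two_neq_0: "(2::'k) \<noteq> 0"
    and n_ge_2: "n \<ge> 2"
    and x_neq_0: "i < n \<Longrightarrow> x i \<noteq> 0"
    and nonadjacent: "Suc i < j \<Longrightarrow> j < n \<Longrightarrow> bracket (x i) (x j) = 0"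
    and adjacent_up: "Suc i < n \<Longrightarrow> bracket (x i) (bracket (x i) (x (Suc i))) = 2 *\<^sub>L x i"
    and adjacent_down: "Suc i < n \<Longrightarrow> bracket (x (Suc i)) (bracket (x (Suc i)) (x i)) = 2 *\<^sub>L x (Suc i)"
begin

section \<open>Iterated brackets along segments of the path\<close>

lemma nonadjacent': "Suc i < j \<Longrightarrow> j < n \<Longrightarrow> bracket (x j) (x i) = 0"
  using nonadjacent[of i j] by (simp add: bracket_anticomm[of "x j"])

lemma two_cancel: "2 *\<^sub>L u = 2 *\<^sub>L v \<Longrightarrow> u = v"
  using two_neq_0 by simp

lemma two_scale: "2 *\<^sub>L u = u + u"
  using scale_left_distrib[of 1 1 u] by simp

text \<open>The segment from i to i + d. Counting brackets by \<open>d\<close> instead of naming the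
  last vertex makes the recursion primitive and keeps subtraction out of the indices.\<close>

primrec chain :: "nat \<Rightarrow> nat \<Rightarrow> 'l" where
  "chain 0 i = x i"
| "chain (Suc d) i = bracket (x i) (chain d (Suc i))"

lemma chain_nonadjacent:
  assumes "i + d < n" "k < n" "Suc k < i \<or> Suc (i + d) < k"
  shows "bracket (x k) (chain d i) = 0"
  using assms
proof (induction d arbitrary: i)
  case 0
  then show ?case using nonadjacent nonadjacent' by auto
next
  case (Suc d)
  have "bracket (x k) (x i) = 0" using Suc.prems nonadjacent nonadjacent' by auto
  moreover have "bracket (x k) (chain d (Suc i)) = 0" using Suc by auto
  ultimately show ?case by (simp add: bracket_derivation[of "x k" "x i"])
qed

text \<open>A segment may be cut at any edge: \<open>x i\<close> commutes with everything beyond its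
  neighbour, so by the Leibniz rule it acts on the left part alone.\<close>

lemma chain_split:
  "Suc (i + d + e) < n \<Longrightarrow> bracket (chain d i) (chain e (Suc (i + d))) = chain (Suc (d + e)) i"
proof (induction d arbitrary: i)
  case 0
  then show ?case by simp
next
  case (Suc d)
  have 0: "bracket (x i) (chain e (Suc (Suc (i + d)))) = 0"
    using Suc.prems by (intro chain_nonadjacent) auto
  have "bracket (x i) (bracket (chain d (Suc i)) (chain e (Suc (Suc (i + d)))))
      = bracket (bracket (x i) (chain d (Suc i))) (chain e (Suc (Suc (i + d))))"
    unfolding bracket_derivation[of "x i" _ "chain e (Suc (Suc (i + d)))"] 0 by simp
  then show ?case using Suc.IH[of "Suc i"] Suc.prems by simp
qed

text \<open>Only the neighbour itself gives a nonzero value. The last factor of a longer chain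
  commutes with \<open>x k\<close>, so (ad x_k)^2 acts on the shorter chain, leaving a multiple of
  \<open>x k\<close> that this factor kills.\<close>

lemma square_chain_up:
  "Suc (k + d) < n \<Longrightarrow>
    bracket (x k) (bracket (x k) (chain d (Suc k))) = (if d = 0 then 2 else 0) *\<^sub>L x k"
proof (induction d)
  case 0
  then show ?case using adjacent_up by simp
next
  case (Suc d)
  let ?u = "chain d (Suc k)" and ?v = "x (Suc (Suc (k + d)))"
  have kv: "bracket (x k) ?v = 0" using Suc.prems nonadjacent by simp
  have uv: "chain (Suc d) (Suc k) = bracket ?u ?v"
    using chain_split[of "Suc k" d 0] Suc.prems by simp
  have "bracket (x k) (bracket (x k) (bracket ?u ?v)) = bracket (bracket (x k) (bracket (x k) ?u)) ?v"
    by (simp add: bracket_derivation[of "x k" ?u ?v] bracket_derivation[of "x k" "bracket (x k) ?u" ?v] kv)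
  then show ?case unfolding uv using Suc kv by (simp add: bracket_scale_left)
qed

lemma square_chain_down:
  "Suc (i + d) < n \<Longrightarrow>
    bracket (x (Suc (i + d))) (bracket (x (Suc (i + d))) (chain d i))
      = (if d = 0 then 2 else 0) *\<^sub>L x (Suc (i + d))"
proof (induction d arbitrary: i)
  case 0
  then show ?case using adjacent_down by simp
next
  case (Suc d)
  let ?k = "Suc (Suc (i + d))"
  have ki: "bracket (x ?k) (x i) = 0" using Suc.prems nonadjacent' by simp
  have ik: "bracket (x i) (x ?k) = 0" using Suc.prems nonadjacent by simp
  have "bracket (x ?k) (bracket (x ?k) (bracket (x i) (chain d (Suc i))))
      = bracket (x i) (bracket (x ?k) (bracket (x ?k) (chain d (Suc i))))"
    by (simp add: bracket_derivation[of "x ?k" "x i"] ki)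
  then show ?case using Suc.IH[of "Suc i"] Suc.prems ik by (simp add: bracket_scale_right)
qed

text \<open>Under the isomorphism to be constructed, \<open>y i j\<close> corresponds to the product \<open>v i * v j\<close>
  in the symmetric square of the natural module, where \<open>x i\<close> is \<open>v i\<^sup>2 / 2\<close>.\<close>

definition y :: "nat \<Rightarrow> nat \<Rightarrow> 'l" where
  "y i j = (if i = j then 2 *\<^sub>L x i else chain (max i j - min i j) (min i j))"

lemma y_commute: "y i j = y j i"
  by (simp add: y_def max.commute min.commute)

lemma y_same: "y i i = 2 *\<^sub>L x i"
  by (simp add: y_def)

lemma y_chain: "y i (Suc (i + d)) = chain (Suc d) i"
  by (simp add: y_def)

text \<open>Cut vertex k out of the segment: the parts P and Q on its two sides commute, and the
  whole chain is [P, [x_k, Q]]. Premet's identity then expresses its bracket with x_k through (ad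
  x_k)^2 P and (ad x_k)^2 Q, which vanish unless the part is a single vertex.\<close>

lemma bracket_x_interior:
  assumes "Suc (Suc (i + d + e)) < n"
  shows "bracket (x (Suc (i + d))) (chain (Suc (Suc (d + e))) i) =
    (if e = 0 then chain (Suc d) i else 0) - (if d = 0 then chain (Suc e) (Suc (i + d)) else 0)"
proof -
  let ?k = "Suc (i + d)"
  let ?P = "chain d i" and ?Q = "chain e (Suc ?k)"
  have PQ: "bracket ?P ?Q = 0"
    using assms
  proof (induction d arbitrary: i)
    case 0
    then show ?case using chain_nonadjacent[of "Suc (Suc i)" e i] by simp
  next
    case (Suc d)
    have "bracket (x i) (chain e (Suc (Suc (Suc (i + d))))) = 0"
      using Suc.prems by (intro chain_nonadjacent) auto
    moreover have "bracket (chain d (Suc i)) (chain e (Suc (Suc (Suc (i + d))))) = 0"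
      using Suc.IH[of "Suc i"] Suc.prems by simp
    ultimately show ?case
      using bracket_derivation[of "x i" "chain d (Suc i)" "chain e (Suc (Suc (Suc (i + d))))"] by simp
  qed
  have XQ: "bracket (x ?k) ?Q = chain (Suc e) ?k" by simp
  have XP: "bracket (x ?k) ?P = - chain (Suc d) i"
    using chain_split[of i d 0] assms by (simp add: bracket_anticomm[of "x ?k"])
  have "bracket ?P (bracket (x ?k) ?Q) = chain (Suc (Suc (d + e))) i"
    unfolding XQ using chain_split[of i d "Suc e"] assms by simp
  then have "2 *\<^sub>L bracket (x ?k) (chain (Suc (Suc (d + e))) i)
      = - ((if d = 0 then 2 else 0) *\<^sub>L chain (Suc e) ?k) - (if e = 0 then 2 else 0) *\<^sub>L (- chain (Suc d) i)"
    using premet_commuting[OF PQ square_chain_down[of i d] square_chain_up[of ?k e]] assms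
    by (simp only: XQ XP)
  also have "\<dots> = 2 *\<^sub>L ((if e = 0 then chain (Suc d) i else 0)
      - (if d = 0 then chain (Suc e) (Suc (i + d)) else 0))"
    by (simp add: scale_right_diff_distrib)
  finally show ?thesis by (rule two_cancel)
qed

lemma bracket_x_y_aux:
  assumes "i \<le> j" "j < n" "k < n"
  shows "bracket (x k) (y i j) = path_form k i *\<^sub>L y k j + path_form k j *\<^sub>L y k i"
proof -
  \<comment> \<open>The position of k relative to the segment: far outside, extending it at either
    end, at an end, or strictly inside. Extending at the upper end puts \<open>x k\<close> on the
    right of the bracket, whence the sign -1; only the last case needs Premet's identity.\<close>
  consider "i = j" | "i < j" "Suc k < i \<or> Suc j < k" | "i < j" "Suc k = i" | "i < j" "k = Suc j"
    | "i < j" "k = i" | "i < j" "k = j" | "i < k" "k < j"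
    using assms by linarith
  then show ?thesis
  proof cases
    case 1
    consider "k = i" | "k = Suc i" | "i = Suc k" | "Suc i < k \<or> Suc k < i" by linarith
    then show ?thesis
    proof cases
      case 1
      then show ?thesis using \<open>i = j\<close> by (simp add: y_same bracket_scale_right bracket_self)
    next
      case 2
      then show ?thesis using \<open>i = j\<close> y_chain[of i 0]
        by (simp add: y_same y_commute[of "Suc j" j] bracket_add_right two_scale
            bracket_anticomm[of "x (Suc j)" "x j"])
    next
      case 3
      then show ?thesis using \<open>i = j\<close> y_chain[of k 0]
        by (simp add: y_same bracket_add_right two_scale)
    next
      case 4
      then show ?thesis using \<open>i = j\<close> assms nonadjacent[of k i] nonadjacent'[of i k]
        by (auto simp: y_same bracket_scale_right path_form_def)
    qed
  next
    case 2
    then obtain d where d: "j = Suc (i + d)" using less_imp_Suc_add by blast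
    have "bracket (x k) (chain (Suc d) i) = 0"
      using 2 assms d by (intro chain_nonadjacent) auto
    moreover have "path_form k i = (0::'k)" "path_form k j = (0::'k)"
      using 2 by (auto simp: path_form_def)
    ultimately show ?thesis by (simp only: d y_chain) simp
  next
    case 3
    then obtain d where d: "j = Suc (i + d)" using less_imp_Suc_add by blast
    have "path_form k i = (1::'k)" "path_form k j = (0::'k)"
      using 3 by (auto simp: path_form_def)
    moreover have "y k j = bracket (x k) (y i j)"
      using y_chain[of k "Suc d"] y_chain[of i d] d 3 by auto
    ultimately show ?thesis by simp
  next
    case 4
    then obtain d where d: "j = Suc (i + d)" using less_imp_Suc_add by blast
    have "path_form k i = (0::'k)" "path_form k j = (-1::'k)"
      using 4 by (auto simp: path_form_def)
    moreover have "y k i = bracket (y i j) (x k)"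
      using y_chain[of i "Suc d"] y_chain[of i d] d 4 chain_split[of i "Suc d" 0] assms
      by (simp add: y_commute[of "Suc (Suc (i + d))" i])
    ultimately show ?thesis by (simp add: bracket_anticomm[of "x k"])
  next
    case 5
    then obtain d where d: "j = Suc (i + d)" using less_imp_Suc_add by blast
    have "path_form k i = (0::'k)" "path_form k j = (if d = 0 then 1 else 0 :: 'k)"
      using 5 d by (auto simp: path_form_def)
    then show ?thesis
      using square_chain_up[of k d] d 5 assms y_chain[of i d] by (simp add: y_same)
  next
    case 6
    then obtain d where d: "j = Suc (i + d)" using less_imp_Suc_add by blast
    have c: "path_form k j = (0::'k)" "path_form k i = (if d = 0 then -1 else 0 :: 'k)"
      using 6 d by (auto simp: path_form_def)
    have yij: "y i j = bracket (chain d i) (x j)"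
      using chain_split[of i d 0] y_chain[of i d] d assms by simp
    have "bracket (x j) (y i j) = - bracket (x j) (bracket (x j) (chain d i))"
      unfolding yij bracket_anticomm[of "chain d i"] by (rule bracket_minus_right)
    then show ?thesis
      using square_chain_down[of i d] d 6 assms c by (simp add: y_same)
  next
    case 7
    then obtain d where d: "k = Suc (i + d)" using less_imp_Suc_add by blast
    obtain e where e: "j = Suc (k + e)" using 7 less_imp_Suc_add by blast
    have c: "path_form k j = (if e = 0 then 1 else 0 :: 'k)" "path_form k i = (if d = 0 then -1 else 0 :: 'k)"
      using 7 d e by (auto simp: path_form_def)
    have y: "y i j = chain (Suc (Suc (d + e))) i" "y k j = chain (Suc e) k" "y k i = chain (Suc d) i"
      using y_chain[of i "Suc (d + e)"] y_chain[of k e] y_chain[of i d] d e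
      by (simp_all add: y_commute[of "Suc (i + d)" i] add.assoc)
    have "Suc (Suc (i + d + e)) < n" using assms d e by simp
    from bracket_x_interior[OF this] show ?thesis unfolding c y unfolding d
      by (simp del: chain.simps)
  qed
qed

lemma bracket_x_y:
  assumes "i < n" "j < n" "k < n"
  shows "bracket (x k) (y i j) = path_form k i *\<^sub>L y k j + path_form k j *\<^sub>L y k i"
proof (cases "i \<le> j")
  case True
  then show ?thesis using bracket_x_y_aux assms by simp
next
  case False
  then show ?thesis using bracket_x_y_aux[of j i k] assms by (simp add: y_commute[of i j] add.commute)
qed

end

subsection \<open>Symmetric matrices as a Lie algebra\<close>

text \<open>Matrices of all sizes share one type, so the ring laws carry dimension conditions. With
  the size fixed they work as conditional rewrite rules, bringing products into right-nested
  form.\<close>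

lemma square_mat_closed:
  shows "A \<in> carrier_mat n n \<Longrightarrow> B \<in> carrier_mat n n \<Longrightarrow> A + B \<in> carrier_mat n n"
    and "A \<in> carrier_mat n n \<Longrightarrow> B \<in> carrier_mat n n \<Longrightarrow> A - B \<in> carrier_mat n n"
    and "A \<in> carrier_mat n n \<Longrightarrow> B \<in> carrier_mat n n \<Longrightarrow> A * B \<in> carrier_mat n n"
    and "A \<in> carrier_mat n n \<Longrightarrow> c \<cdot>\<^sub>m A \<in> carrier_mat n n"
    and "A \<in> carrier_mat n n \<Longrightarrow> - A \<in> carrier_mat n n"
    and "A \<in> carrier_mat n n \<Longrightarrow> A\<^sup>T \<in> carrier_mat n n"
  by auto

lemma square_mat_distrib:
  fixes A B C :: "'k::comm_ring_1 mat"
  assumes "A \<in> carrier_mat n n" "B \<in> carrier_mat n n" "C \<in> carrier_mat n n"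
  shows "(A + B) * C = A * C + B * C" and "A * (B + C) = A * B + A * C"
    and "(A - B) * C = A * C - B * C" and "A * (B - C) = A * B - A * C"
    and "A * B * C = A * (B * C)"
  using assms by (simp_all add: add_mult_distrib_mat[of _ n n _ _ n] mult_add_distrib_mat[of _ n n _ n]
      minus_mult_distrib_mat[of _ n n _ _ n] mult_minus_distrib_mat[of _ n n _ n] assoc_mult_mat[of _ n n _ n _ n])

lemma square_mat_smult:
  fixes A B :: "'k::comm_ring_1 mat"
  assumes "A \<in> carrier_mat n n" "B \<in> carrier_mat n n"
  shows "(c \<cdot>\<^sub>m A) * B = c \<cdot>\<^sub>m (A * B)" and "A * (c \<cdot>\<^sub>m B) = c \<cdot>\<^sub>m (A * B)"
    and "(- A) * B = - (A * B)" and "A * (- B) = - (A * B)"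
    and "(A * B)\<^sup>T = B\<^sup>T * A\<^sup>T"
  using assms by (simp_all add: mult_smult_assoc_mat[of _ n n _ n] mult_smult_distrib[of _ n n _ n]
      transpose_mult[of _ n n _ n])

lemmas square_mat = square_mat_closed square_mat_distrib square_mat_smult

text \<open>The Kronecker delta as an opaque factor: products can be rearranged without case splits
  before \<open>sum_kron\<close> collapses the sum.\<close>

definition kron :: "nat \<Rightarrow> nat \<Rightarrow> 'k::comm_ring_1" where
  "kron i a = (if a = i then 1 else 0)"

lemma sum_kron:
  assumes "i < n"
  shows "(\<Sum>a<n. kron i a * f a) = f i"
proof -
  have "(\<Sum>a<n. kron i a * f a) = (\<Sum>a<n. if a = i then f a else 0)"
    by (rule sum.cong) (simp_all add: kron_def)
  then show ?thesis using assms by simp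
qed

definition path_mat :: "nat \<Rightarrow> 'k::comm_ring_1 mat" where
  "path_mat n = mat n n (\<lambda>(i, j). path_form i j)"

definition sym_mats :: "nat \<Rightarrow> 'k mat set" where
  "sym_mats n = {S \<in> carrier_mat n n. S\<^sup>T = S}"

text \<open>If \<open>path_mat n\<close> is the Gram matrix of an alternating form, then a symmetric matrix \<open>S\<close>
  represents the skew endomorphism \<open>S * path_mat n\<close>, and this is the bracket induced by the
  commutator of endomorphisms.\<close>

definition path_bracket :: "'k::comm_ring_1 mat \<Rightarrow> 'k mat \<Rightarrow> 'k mat" where
  "path_bracket S T = S * path_mat (dim_row S) * T - T * path_mat (dim_row S) * S"

text \<open>The tensor of v_i v_j. On the diagonal it is twice a matrix unit, in agreement with
  \<open>y_same\<close>.\<close>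

definition sym_unit :: "nat \<Rightarrow> nat \<Rightarrow> nat \<Rightarrow> 'k::comm_ring_1 mat" where
  "sym_unit n i j = mat n n (\<lambda>(a, b). kron i a * kron j b + kron j a * kron i b)"

lemma path_mat_carrier [simp]: "path_mat n \<in> carrier_mat n n"
  and path_mat_index [simp]: "i < n \<Longrightarrow> j < n \<Longrightarrow> path_mat n $$ (i, j) = path_form i j"
  by (auto simp: path_mat_def)

lemma transpose_path_mat: "(path_mat n)\<^sup>T = - path_mat n"
  by (intro eq_matI) (auto simp: path_mat_def path_form_def)

lemma sym_unit_carrier [simp]: "sym_unit n i j \<in> carrier_mat n n"
  and sym_unit_index [simp]: "a < n \<Longrightarrow> b < n \<Longrightarrow>
    sym_unit n i j $$ (a, b) = kron i a * kron j b + kron j a * kron i b"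
  by (auto simp: sym_unit_def)

lemma path_mat_dim [simp]: "dim_row (path_mat n) = n" "dim_col (path_mat n) = n"
  and sym_unit_dim [simp]: "dim_row (sym_unit n i j) = n" "dim_col (sym_unit n i j) = n"
  by (simp_all add: path_mat_def sym_unit_def)

lemma sym_unit_sym [simp]: "(sym_unit n i j :: 'k::comm_ring_1 mat) \<in> sym_mats n"
proof -
  have "(sym_unit n i j :: 'k mat)\<^sup>T = sym_unit n i j"
    by (rule eq_matI) (simp_all add: sym_unit_def algebra_simps)
  then show ?thesis unfolding sym_mats_def by simp
qed

lemma sym_matsD: "S \<in> sym_mats n \<Longrightarrow> S \<in> carrier_mat n n" "S \<in> sym_mats n \<Longrightarrow> S\<^sup>T = S"
  by (auto simp: sym_mats_def)

lemma sym_mats_add: "S \<in> sym_mats n \<Longrightarrow> T \<in> sym_mats n \<Longrightarrow> S + T \<in> sym_mats n"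
  by (auto simp: sym_mats_def transpose_add[of _ n n])

lemma sym_mats_smult:
  assumes "S \<in> sym_mats n"
  shows "c \<cdot>\<^sub>m S \<in> sym_mats n"
proof -
  have "(c \<cdot>\<^sub>m S)\<^sup>T = c \<cdot>\<^sub>m S\<^sup>T" by (rule eq_matI) auto
  then show ?thesis using assms by (simp add: sym_mats_def)
qed

text \<open>As c is skew, transposition exchanges S c T with - T c S.\<close>

lemma sym_mats_path_bracket:
  fixes S T :: "'k::comm_ring_1 mat"
  assumes "S \<in> sym_mats n" "T \<in> sym_mats n"
  shows "path_bracket S T \<in> sym_mats n"
proof -
  note [simp] = sym_matsD[OF assms(1)] sym_matsD[OF assms(2)]
  have [simp]: "dim_row S = n" "dim_row T = n"
    by (rule carrier_matD(1)[OF sym_matsD(1)], fact)+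
  have 1: "(S * path_mat n * T)\<^sup>T = - (T * path_mat n * S)"
    by (simp add: square_mat[where n = n] transpose_path_mat)
  have 2: "(T * path_mat n * S)\<^sup>T = - (S * path_mat n * T)"
    by (simp add: square_mat[where n = n] transpose_path_mat)
  have c: "S * path_mat n * T \<in> carrier_mat n n" "T * path_mat n * S \<in> carrier_mat n n"
    by (simp_all add: square_mat_closed[where n = n])
  have "- M - - N = N - M" if "M \<in> carrier_mat n n" "N \<in> carrier_mat n n" for M N :: "'k mat"
    by (rule eq_matI) (use that in auto)
  then have "(path_bracket S T)\<^sup>T = path_bracket S T"
    using c by (simp only: path_bracket_def transpose_minus[of _ n n] 1 2 \<open>dim_row S = n\<close>)
  then show ?thesis using c by (simp add: sym_mats_def path_bracket_def square_mat_closed)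
qed

lemma path_bracket_carrier:
  "S \<in> carrier_mat n n \<Longrightarrow> T \<in> carrier_mat n n \<Longrightarrow> path_bracket S T \<in> carrier_mat n n"
  unfolding path_bracket_def by (simp add: square_mat_closed[where n = n])

lemma path_bracket_add_left:
  assumes "S \<in> carrier_mat n n" "T \<in> carrier_mat n n" "R \<in> carrier_mat n n"
  shows "path_bracket (S + T) R = path_bracket S R + path_bracket T R"
proof -
  have "A + B - (C + D) = A - C + (B - D)"
    if "A \<in> carrier_mat n n" "B \<in> carrier_mat n n" "C \<in> carrier_mat n n" "D \<in> carrier_mat n n"
    for A B C D :: "'a mat"
    by (rule eq_matI) (use that in auto)
  then show ?thesis using assms carrier_matD(1)[OF assms(1)] carrier_matD(1)[OF assms(2)]
    by (simp add: path_bracket_def square_mat[where n = n])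
qed

lemma path_bracket_smult_left:
  assumes "S \<in> carrier_mat n n" "R \<in> carrier_mat n n"
  shows "path_bracket (c \<cdot>\<^sub>m S) R = c \<cdot>\<^sub>m path_bracket S R"
proof -
  have "c \<cdot>\<^sub>m A - c \<cdot>\<^sub>m B = c \<cdot>\<^sub>m (A - B)" if "A \<in> carrier_mat n n" "B \<in> carrier_mat n n" for A B :: "'a mat"
    by (rule eq_matI) (use that in \<open>auto simp: algebra_simps\<close>)
  then show ?thesis using assms carrier_matD(1)[OF assms(1)]
    by (simp add: path_bracket_def square_mat[where n = n])
qed

text \<open>The sign is a scalar multiple so that additivity and homogeneity of
  \<open>sym_map\<close> can be applied to it.\<close>

lemma path_bracket_anticomm:
  assumes "S \<in> carrier_mat n n" "T \<in> carrier_mat n n"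
  shows "path_bracket T S = (-1) \<cdot>\<^sub>m path_bracket S T"
proof -
  have *: "A - B = (-1) \<cdot>\<^sub>m (B - A)" if "A \<in> carrier_mat n n" "B \<in> carrier_mat n n" for A B :: "'a mat"
    by (rule eq_matI) (use that in auto)
  show ?thesis
    unfolding path_bracket_def carrier_matD(1)[OF assms(1)] carrier_matD(1)[OF assms(2)]
    by (rule *) (use assms in \<open>simp_all add: square_mat_closed[where n = n]\<close>)
qed

lemma path_bracket_jacobi:
  assumes "S \<in> carrier_mat n n" "T \<in> carrier_mat n n" "R \<in> carrier_mat n n"
  shows "path_bracket (path_bracket R T) S =
    path_bracket R (path_bracket T S) + (-1) \<cdot>\<^sub>m path_bracket T (path_bracket R S)"
proof -
  \<comment> \<open>\<open>P\<close> and \<open>Q\<close> stand for R c S c T and T c S c R, the two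
    words with S in the middle, which cancel.\<close>
  have "A - P - (Q - D) + (-1) \<cdot>\<^sub>m (B - Q - (P - C)) = A - B - (C - D)"
    if "A \<in> carrier_mat n n" "B \<in> carrier_mat n n" "C \<in> carrier_mat n n" "D \<in> carrier_mat n n"
      "P \<in> carrier_mat n n" "Q \<in> carrier_mat n n"
    for A B C D P Q :: "'a mat"
    by (rule eq_matI) (use that in auto)
  then show ?thesis
    using assms carrier_matD(1)[OF assms(1)] carrier_matD(1)[OF assms(2)] carrier_matD(1)[OF assms(3)]
    by (simp add: path_bracket_def square_mat[where n = n])
qed

text \<open>Summing T_ij times \<open>sym_unit n i j\<close> over all ordered pairs gives T plus its
  transpose, that is 2 T; halving recovers T.\<close>

lemma sym_mats_induct [consumes 3, case_names unit add smult]: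
  fixes T :: "'k::field mat"
  assumes two: "(2::'k) \<noteq> 0" and T: "T \<in> sym_mats n" and n: "0 < n"
    and unit: "\<And>i j. i < n \<Longrightarrow> j < n \<Longrightarrow> P (sym_unit n i j)"
    and add: "\<And>S T. S \<in> sym_mats n \<Longrightarrow> T \<in> sym_mats n \<Longrightarrow> P S \<Longrightarrow> P T \<Longrightarrow> P (S + T)"
    and smult: "\<And>c S. S \<in> sym_mats n \<Longrightarrow> P S \<Longrightarrow> P (c \<cdot>\<^sub>m S)"
  shows "P T"
proof -
  \<comment> \<open>The zero matrix, as a multiple of a spanning matrix, starts the induction over
    finite sets of index pairs.\<close>
  have "0 \<cdot>\<^sub>m sym_unit n 0 0 = (0\<^sub>m n n :: 'k mat)"
    by (rule eq_matI) (auto simp: sym_unit_def)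
  then have zero: "P (0\<^sub>m n n)" using smult[OF sym_unit_sym unit, of 0 0 0] n by simp
  define M where "M A = mat n n (\<lambda>(a, b). \<Sum>(i, j)\<in>A. T $$ (i, j) * sym_unit n i j $$ (a, b))" for A
  have "P (M A) \<and> M A \<in> sym_mats n" if "finite A" "A \<subseteq> {..<n} \<times> {..<n}" for A
    using that
  proof (induction A rule: finite_induct)
    case empty
    have "M {} = 0\<^sub>m n n" by (auto simp: M_def)
    then show ?case using zero by (simp add: sym_mats_def)
  next
    case (insert p A)
    obtain i j where p: "p = (i, j)" by force
    have "M (insert p A) = T $$ (i, j) \<cdot>\<^sub>m sym_unit n i j + M A"
      by (rule eq_matI) (use insert.hyps in \<open>auto simp: M_def p sym_unit_def\<close>)
    then show ?case using insert p unit add smult by (simp add: sym_mats_add sym_mats_smult)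
  qed
  then have PM: "P (M ({..<n} \<times> {..<n}))" "M ({..<n} \<times> {..<n}) \<in> sym_mats n" by auto
  have "(1/2) \<cdot>\<^sub>m M ({..<n} \<times> {..<n}) = T"
  proof (rule eq_matI)
    fix a b assume ab': "a < dim_row T" "b < dim_col T"
    have ab: "a < n" "b < n" using ab' sym_matsD(1)[OF T] by auto
    have "(\<Sum>i<n. \<Sum>j<n. T $$ (i, j) * sym_unit n i j $$ (a, b)) =
      (\<Sum>i<n. kron a i * (\<Sum>j<n. kron b j * T $$ (i, j))) +
      (\<Sum>i<n. kron b i * (\<Sum>j<n. kron a j * T $$ (i, j)))"
      unfolding sum.distrib[symmetric] sum_distrib_left using ab
      by (intro sum.cong refl) (simp add: algebra_simps kron_def)
    also have "\<dots> = T $$ (a, b) + T $$ (b, a)"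
      using ab by (simp add: sum_kron)
    also have "T $$ (b, a) = T $$ (a, b)"
      using sym_matsD(2)[OF T] ab' ab sym_matsD(1)[OF T] by (metis index_transpose_mat(1) carrier_matD)
    finally show "((1/2) \<cdot>\<^sub>m M ({..<n} \<times> {..<n})) $$ (a, b) = T $$ (a, b)"
      using ab two by (simp add: M_def sum.cartesian_product[symmetric])
  qed (use sym_matsD(1)[OF T] in \<open>auto simp: M_def\<close>)
  then show ?thesis using smult[OF PM(2,1)] by metis
qed

lemma mult_sym_unit_index:
  assumes "M \<in> carrier_mat n n" "i < n" "j < n" "k < n" "b < n"
  shows "(M * sym_unit n i j) $$ (k, b) = M $$ (k, i) * kron j b + M $$ (k, j) * kron i b"
proof -
  have "(M * sym_unit n i j) $$ (k, b) =
      (\<Sum>a<n. M $$ (k, a) * (kron i a * kron j b + kron j a * kron i b))"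
    using assms by (subst index_mult_mat(1)) (auto simp: scalar_prod_def atLeast0LessThan sym_unit_def)
  also have "\<dots> = (\<Sum>a<n. kron i a * (M $$ (k, a) * kron j b))
      + (\<Sum>a<n. kron j a * (M $$ (k, a) * kron i b))"
    unfolding sum.distrib[symmetric] by (intro sum.cong refl) (simp add: algebra_simps)
  finally show ?thesis using assms by (simp add: sum_kron)
qed

lemma sym_unit_mult_index:
  assumes "N \<in> carrier_mat n n" "i < n" "j < n" "k < n" "l < n"
  shows "(sym_unit n i j * N) $$ (k, l) = kron i k * N $$ (j, l) + kron j k * N $$ (i, l)"
proof -
  have "(sym_unit n i j * N) $$ (k, l) =
      (\<Sum>a<n. (kron i k * kron j a + kron j k * kron i a) * N $$ (a, l))"
    using assms by (subst index_mult_mat(1)) (auto simp: scalar_prod_def atLeast0LessThan sym_unit_def)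
  also have "\<dots> = (\<Sum>a<n. kron j a * (kron i k * N $$ (a, l))) + (\<Sum>a<n. kron i a * (kron j k * N $$ (a, l)))"
    unfolding sum.distrib[symmetric] by (intro sum.cong refl) (simp add: algebra_simps)
  finally show ?thesis using assms by (simp add: sum_kron)
qed

lemma mult_sym_unit_mult_index:
  assumes "M \<in> carrier_mat n n" "N \<in> carrier_mat n n" "i < n" "j < n" "k < n" "l < n"
  shows "(M * (sym_unit n i j * N)) $$ (k, l) = M $$ (k, i) * N $$ (j, l) + M $$ (k, j) * N $$ (i, l)"
proof -
  have "(M * (sym_unit n i j * N)) $$ (k, l) = (\<Sum>b<n. M $$ (k, b) * (sym_unit n i j * N) $$ (b, l))"
    using assms by (subst index_mult_mat(1)) (auto simp: scalar_prod_def atLeast0LessThan sym_unit_def)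
  also have "\<dots> = (\<Sum>b<n. kron i b * (M $$ (k, b) * N $$ (j, l)))
      + (\<Sum>b<n. kron j b * (M $$ (k, b) * N $$ (i, l)))"
    unfolding sum.distrib[symmetric] using assms
    by (intro sum.cong refl) (simp add: sym_unit_mult_index del: index_mult_mat, simp add: algebra_simps)
  finally show ?thesis using assms by (simp add: sum_kron)
qed

text \<open>The counterpart of \<open>bracket_x_y\<close>; the coefficients are doubled because
  \<open>sym_unit n k k\<close> corresponds to 2 x_k.\<close>

lemma path_bracket_sym_units:
  assumes "k < n" "i < n" "j < n"
  shows "path_bracket (sym_unit n k k) (sym_unit n i j) =
    (2 * path_form k i) \<cdot>\<^sub>m sym_unit n k j + (2 * path_form k j) \<cdot>\<^sub>m sym_unit n k i" (is "?L = ?R")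
proof (rule eq_matI)
  fix p q assume "p < dim_row ?R" "q < dim_col ?R"
  then have pq: "p < n" "q < n" by (simp_all add: sym_unit_def)
  have d: "dim_row (sym_unit n a b) = n" "dim_col (sym_unit n a b) = n" for a b
    by (simp_all add: sym_unit_def)
  have *: "((sym_unit n a b * path_mat n * sym_unit n c d)) $$ (p, q) =
     (kron a p * path_form b c + kron b p * path_form a c) * kron d q +
     (kron a p * path_form b d + kron b p * path_form a d) * kron c q"
    if "a < n" "b < n" "c < n" "d < n" for a b c d
    using that pq
    by (simp add: mult_sym_unit_index[where n = n] sym_unit_mult_index[where n = n] square_mat_closed[where n = n]
      del: index_mult_mat)
  show "?L $$ (p, q) = ?R $$ (p, q)"
    using assms pq unfolding path_bracket_def d
    by (simp add: d * path_form_skew[of i k] path_form_skew[of j k] algebra_simps del: index_mult_mat(1))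
qed (simp_all add: path_bracket_def sym_unit_def)

subsection \<open>From symmetric matrices to the generated Lie algebra\<close>

context path_generators
begin

lemma four_neq_0: "(4::'k) \<noteq> 0"
proof -
  have "(4::'k) = 2 * 2" by simp
  then show ?thesis using two_neq_0 by (metis mult_eq_0_iff)
qed

lemma sum_kron_scale:
  assumes "i < n"
  shows "(\<Sum>a<n. kron i a *\<^sub>L f a) = f i"
proof -
  have "(\<Sum>a<n. kron i a *\<^sub>L f a) = (\<Sum>a<n. if a = i then f a else 0)"
    by (rule sum.cong) (simp_all add: kron_def)
  then show ?thesis using assms by simp
qed

text \<open>Entries (i, j) and (j, i) both contribute, hence the halves; a diagonal entry
  contributes S_ii/2 times 2 x_i.\<close>

definition sym_map :: "'k mat \<Rightarrow> 'l" where
  "sym_map S = (\<Sum>i<n. \<Sum>j<n. (S $$ (i, j) / 2) *\<^sub>L y i j)"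

lemma sym_map_add:
  "S \<in> carrier_mat n n \<Longrightarrow> T \<in> carrier_mat n n \<Longrightarrow> sym_map (S + T) = sym_map S + sym_map T"
  unfolding sym_map_def sum.distrib[symmetric]
  by (intro sum.cong refl) (simp add: add_divide_distrib scale_left_distrib)

lemma sym_map_smult: "S \<in> carrier_mat n n \<Longrightarrow> sym_map (c \<cdot>\<^sub>m S) = c *\<^sub>L sym_map S"
  unfolding sym_map_def scale_sum_right by (intro sum.cong refl) simp

lemma sym_map_unit:
  assumes "i < n" "j < n"
  shows "sym_map (sym_unit n i j) = y i j"
proof -
  have "sym_map (sym_unit n i j) =
      (\<Sum>a<n. kron i a *\<^sub>L (\<Sum>b<n. kron j b *\<^sub>L (1/2) *\<^sub>L y a b)) +
      (\<Sum>a<n. kron j a *\<^sub>L (\<Sum>b<n. kron i b *\<^sub>L (1/2) *\<^sub>L y a b))"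
    unfolding sym_map_def scale_sum_right sum.distrib[symmetric]
    by (intro sum.cong refl) (simp add: add_divide_distrib scale_left_distrib)
  also have "\<dots> = (1/2) *\<^sub>L (2 *\<^sub>L y i j)"
    using assms y_commute[of i j] by (simp only: sum_kron_scale two_scale scale_right_distrib)
  also have "\<dots> = y i j" using two_neq_0 by simp
  finally show ?thesis .
qed

lemma sym_map_bracket_generator_unit:
  assumes "k < n" "i < n" "j < n"
  shows "sym_map (path_bracket (sym_unit n k k) (sym_unit n i j)) = bracket (y k k) (y i j)"
  using assms
  by (simp add: path_bracket_sym_units sym_map_add sym_map_smult sym_map_unit square_mat_closed
      y_same[of k] bracket_scale_left bracket_x_y scale_right_distrib)

lemma sym_map_path_bracket_add_right:
  assumes "S \<in> carrier_mat n n" "T \<in> carrier_mat n n" "R \<in> carrier_mat n n"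
  shows "sym_map (path_bracket R (S + T)) = sym_map (path_bracket R S) + sym_map (path_bracket R T)"
  using assms
  by (simp add: path_bracket_anticomm[of _ n R] path_bracket_add_left[of _ n] path_bracket_carrier
      sym_map_add sym_map_smult square_mat_closed scale_right_distrib)

lemma sym_map_path_bracket_smult_right:
  assumes "S \<in> carrier_mat n n" "R \<in> carrier_mat n n"
  shows "sym_map (path_bracket R (c \<cdot>\<^sub>m S)) = c *\<^sub>L sym_map (path_bracket R S)"
  using assms
  by (simp add: path_bracket_anticomm[of _ n R] path_bracket_smult_left[of _ n] path_bracket_carrier
      sym_map_smult square_mat_closed)

lemma n_pos: "0 < n"
  using n_ge_2 by simp

lemma sym_map_bracket_generator:
  assumes "k < n" "S \<in> sym_mats n"
  shows "sym_map (path_bracket (sym_unit n k k) S) = bracket (y k k) (sym_map S)"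
  using two_neq_0 assms(2) n_pos
proof (induction S rule: sym_mats_induct)
  case (unit i j)
  then show ?case using sym_map_bracket_generator_unit sym_map_unit assms by simp
next
  case (add S T)
  then show ?case
    by (simp add: sym_map_path_bracket_add_right sym_map_add sym_matsD bracket_add_right)
next
  case (smult c S)
  then show ?case
    by (simp add: sym_map_path_bracket_smult_right sym_map_smult sym_matsD bracket_scale_right)
qed

text \<open>The Jacobi identity holds on both sides, so the symmetric matrices whose left bracket is
  respected by \<open>sym_map\<close> are closed under \<open>path_bracket\<close>. This carries the
  homomorphism property from the diagonal generators to all spanning matrices.\<close>

lemma sym_map_bracket_step:
  assumes R: "R \<in> sym_mats n" "\<And>S. S \<in> sym_mats n \<Longrightarrow> sym_map (path_bracket R S) = bracket (sym_map R) (sym_map S)"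
    and T: "T \<in> sym_mats n" "\<And>S. S \<in> sym_mats n \<Longrightarrow> sym_map (path_bracket T S) = bracket (sym_map T) (sym_map S)"
    and S: "S \<in> sym_mats n"
  shows "sym_map (path_bracket (path_bracket R T) S) = bracket (sym_map (path_bracket R T)) (sym_map S)"
  using assms
  by (simp add: path_bracket_jacobi[of _ n] sym_matsD sym_map_add sym_map_smult path_bracket_carrier
      square_mat_closed sym_mats_path_bracket bracket_derivation[of "sym_map R" "sym_map T" "sym_map S"])

lemma sym_map_bracket_unit:
  "i + d < n \<Longrightarrow> S \<in> sym_mats n \<Longrightarrow>
    sym_map (path_bracket (sym_unit n i (i + d)) S) = bracket (y i (i + d)) (sym_map S)"
proof (induction d arbitrary: i S)
  case 0
  then show ?case using sym_map_bracket_generator by simp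
next
  case (Suc d)
  let ?R = "sym_unit n i i :: 'k mat" and ?T = "sym_unit n (Suc i) (Suc i + d) :: 'k mat"
  \<comment> \<open>The coefficient in [v_i^2, v_(i+1) v_(i+1+d)] = \<open>?c\<close> v_i v_(i+1+d).
    For d = 0 both factors are neighbours of i, and the two contributions of 2 add up.\<close>
  let ?c = "if d = 0 then 4 else 2 :: 'k"
  have c: "?c \<noteq> 0" using two_neq_0 four_neq_0 by simp
  have "path_bracket ?R ?T = ?c \<cdot>\<^sub>m sym_unit n i (i + Suc d)"
    using Suc.prems
    by (subst path_bracket_sym_units) (auto simp: path_form_def intro!: eq_matI simp: sym_unit_def algebra_simps)
  then have RT: "sym_unit n i (i + Suc d) = inverse ?c \<cdot>\<^sub>m path_bracket ?R ?T"
    using c by (auto intro!: eq_matI)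
  have "sym_map (path_bracket (path_bracket ?R ?T) S) = bracket (sym_map (path_bracket ?R ?T)) (sym_map S)"
    using Suc.prems Suc.IH[of "Suc i"] sym_map_bracket_generator[of i]
    by (intro sym_map_bracket_step) (auto simp: sym_map_unit)
  then have "sym_map (path_bracket (sym_unit n i (i + Suc d)) S)
      = bracket (sym_map (sym_unit n i (i + Suc d))) (sym_map S)"
    unfolding RT using Suc.prems
    by (simp add: path_bracket_smult_left[of _ n] sym_map_smult path_bracket_carrier sym_matsD bracket_scale_left)
  then show ?case using Suc.prems by (simp add: sym_map_unit)
qed

lemma sym_unit_commute: "sym_unit m i j = sym_unit m j i"
  by (simp add: sym_unit_def add.commute)

lemma sym_map_bracket:
  assumes "T \<in> sym_mats n" "S \<in> sym_mats n"
  shows "sym_map (path_bracket T S) = bracket (sym_map T) (sym_map S)"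
  using two_neq_0 assms(1) n_pos
proof (induction T rule: sym_mats_induct)
  case (unit i j)
  show ?case
  proof (cases "i \<le> j")
    case True
    then show ?thesis using sym_map_bracket_unit[of i "j - i" S] unit assms by (simp add: sym_map_unit)
  next
    case False
    then show ?thesis using sym_map_bracket_unit[of j "i - j" S] unit assms
      by (simp add: sym_map_unit sym_unit_commute[of n i j] y_commute[of i j])
  qed
next
  case (add R T)
  then show ?case using assms
    by (simp add: path_bracket_add_left[of _ n] sym_map_add sym_matsD path_bracket_carrier bracket_add_left)
next
  case (smult c T)
  then show ?case using assms
    by (simp add: path_bracket_smult_left[of _ n] sym_map_smult sym_matsD path_bracket_carrier bracket_scale_left)
qed

text \<open>Bracketing \<open>S\<close> twice with \<open>sym_unit n k k\<close> gives a multiple of \<open>sym_unit n k k\<close> by this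
  diagonal entry, and \<open>x k\<close> is nonzero.\<close>

lemma kernel_diagonal:
  assumes S: "S \<in> sym_mats n" and ker: "sym_map S = 0" and k: "k < n"
  shows "(path_mat n * (S * path_mat n)) $$ (k, k) = 0"
proof -
  let ?C = "path_mat n :: 'k mat" and ?F = "sym_unit n k k :: 'k mat"
  let ?D = "?C * (S * ?C)"
  note S' = sym_matsD[OF S]
  have d: "dim_row S = n" "dim_row ?F = n" using S' by (auto simp: sym_unit_def)
  \<comment> \<open>As c(k, k) = 0, the outer two of the four terms of the double bracket vanish.
    The two middle terms agree, and each is - 2 D_kk times \<open>?F\<close>, which accounts for the
    factor -4 below.\<close>
  have FCF: "?F * (?C * ?F) = 0\<^sub>m n n"
    by (rule eq_matI)
      (use k in \<open>auto simp: sym_unit_mult_index[where n = n] mult_sym_unit_index[where n = n] square_mat_closed[where n = n] simp del: index_mult_mat(1)\<close>)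
  have FDF: "?F * (?D * ?F) = (2 * ?D $$ (k, k)) \<cdot>\<^sub>m ?F"
    by (rule eq_matI)
      (use k S' in \<open>auto simp: sym_unit_mult_index[where n = n] mult_sym_unit_index[where n = n] square_mat_closed[where n = n] algebra_simps simp del: index_mult_mat(1)\<close>)
  have A: "A - B - (B - C) = (-2) \<cdot>\<^sub>m B"
    if "A = 0\<^sub>m n n" "B \<in> carrier_mat n n" "C = 0\<^sub>m n n" for A B C :: "'k mat"
    by (rule eq_matI) (use that in auto)
  have "path_bracket ?F (path_bracket ?F S) =
     (?F * (?C * ?F)) * (?C * S) - ?F * (?D * ?F) - (?F * (?D * ?F) - S * (?C * (?F * (?C * ?F))))"
    using S' by (simp add: path_bracket_def d square_mat[where n = n])
  also have "\<dots> = (-2) \<cdot>\<^sub>m (?F * (?D * ?F))"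
    using S' by (intro A) (auto simp: FCF square_mat_closed[where n = n])
  also have "\<dots> = (-4 * ?D $$ (k, k)) \<cdot>\<^sub>m ?F"
    unfolding FDF by (rule eq_matI) auto
  finally have eq: "path_bracket ?F (path_bracket ?F S) = (-4 * ?D $$ (k, k)) \<cdot>\<^sub>m ?F" .
  have "sym_map (path_bracket ?F (path_bracket ?F S)) = 0"
    using k S ker by (simp add: sym_map_bracket_generator sym_mats_path_bracket)
  then have "(-4 * ?D $$ (k, k)) *\<^sub>L (2 *\<^sub>L x k) = 0"
    unfolding eq using k by (simp add: sym_map_smult sym_map_unit y_same)
  then have "-4 * ?D $$ (k, k) = 0 \<or> 2 *\<^sub>L x k = 0" by (simp only: scale_eq_0_iff)
  then show ?thesis
    using two_neq_0 four_neq_0 x_neq_0[OF k] by simp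
qed

text \<open>The kernel of \<open>sym_map\<close> is an ideal, so \<open>kernel_diagonal\<close> also applies to the brackets of
  \<open>S\<close> with all \<open>sym_unit n a b\<close>.\<close>

lemma kernel_trivial:
  assumes S: "S \<in> sym_mats n" and ker: "sym_map S = 0"
  shows "path_mat n * (S * path_mat n) = 0\<^sub>m n n"
proof -
  let ?C = "path_mat n :: 'k mat"
  define D where "D = ?C * (S * ?C)"
  note S' = sym_matsD[OF S]
  have Dc: "D \<in> carrier_mat n n" using S' by (simp add: D_def square_mat_closed[where n = n])
  have "D\<^sup>T = D"
    using S' by (simp add: D_def square_mat[where n = n] transpose_path_mat)
  then have Dsym: "D $$ (i, j) = D $$ (j, i)" if "i < n" "j < n" for i j
    using that Dc by (metis index_transpose_mat(1) carrier_matD)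
  \<comment> \<open>The diagonal condition for the kernel element [v_a v_b, S]. Its matrix C [U, S]
    C equals C U D - D U C, so the condition is linear in the entries of D, including those off the
    diagonal.\<close>
  have *: "path_form k a * D $$ (b, k) + path_form k b * D $$ (a, k) = 0"
    if k: "k < n" and a: "a < n" and b: "b < n" for k a b
  proof -
    let ?U = "sym_unit n a b :: 'k mat"
    have d: "dim_row ?U = n" by (simp add: sym_unit_def)
    have "sym_map (path_bracket ?U S) = 0"
      using S ker by (simp add: sym_map_bracket)
    then have 0: "(?C * (path_bracket ?U S * ?C)) $$ (k, k) = 0"
      using S k by (intro kernel_diagonal sym_mats_path_bracket) auto
    have "?C * (path_bracket ?U S * ?C) = ?C * (?U * D) - D * (?U * ?C)"
      using S' by (simp add: path_bracket_def d D_def square_mat[where n = n])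
    then have "(?C * (path_bracket ?U S * ?C)) $$ (k, k) = (?C * (?U * D)) $$ (k, k) - (D * (?U * ?C)) $$ (k, k)"
      using k Dc by (auto simp: square_mat_closed[where n = n] d simp del: index_mult_mat(1))
    also have "\<dots> = 2 * (path_form k a * D $$ (b, k) + path_form k b * D $$ (a, k))"
      using k a b Dc
      by (simp add: mult_sym_unit_mult_index[where n = n] Dsym[OF k a] Dsym[OF k b]
          path_form_skew[of a k] path_form_skew[of b k] algebra_simps del: index_mult_mat(1))
    finally show ?thesis unfolding 0 using two_neq_0 by (metis mult_eq_0_iff)
  qed
  have "D $$ (b, k) = 0" if k: "k < n" and b: "b < n" for b k
  proof -
    \<comment> \<open>A neighbour a of k. Taking b = a in \<open>*\<close> gives 2 c(k, a) D_ak = 0;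
      for any other b the second term then drops out, leaving D_bk = 0.\<close>
    obtain a where a: "a < n" "path_form k a = (1::'k) \<or> path_form k a = (-1::'k)"
    proof (cases "k = 0")
      case True
      then show ?thesis using n_ge_2 that[of 1] by (simp add: path_form_def)
    next
      case False
      then show ?thesis using k that[of "k - 1"] by (simp add: path_form_def)
    qed
    have "D $$ (a, k) = 0" using *[OF k a(1) a(1)] a(2) two_neq_0 by auto
    then show ?thesis using *[OF k a(1) b] a(2) by auto
  qed
  then have "D = 0\<^sub>m n n" using Dc by (intro eq_matI) auto
  then show ?thesis by (simp add: D_def)
qed

section \<open>Image and injectivity of \<open>sym_map\<close>\<close>

lemma chain_in_lie_span: "i + d < n \<Longrightarrow> chain d i \<in> lie_span (x ` {..<n})"
proof (induction d arbitrary: i)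
  case 0
  then show ?case using lie_span_superset[of "x ` {..<n}"] by auto
next
  case (Suc d)
  then have "x i \<in> lie_span (x ` {..<n})" using lie_span_superset[of "x ` {..<n}"] by auto
  then show ?case using Suc by (simp add: bracket_in_lie_span)
qed

lemma y_in_lie_span:
  assumes "i < n" "j < n"
  shows "y i j \<in> lie_span (x ` {..<n})"
  using assms chain_in_lie_span[of i 0] chain_in_lie_span[of "min i j" "max i j - min i j"]
  by (auto simp: y_def intro: subspace_scale[OF subspace_lie_span])

lemma sym_map_image: "sym_map ` sym_mats n = lie_span (x ` {..<n})"
proof
  show "sym_map ` sym_mats n \<subseteq> lie_span (x ` {..<n})"
    unfolding sym_map_def
    by (auto intro!: subspace_sum[OF subspace_lie_span] subspace_scale[OF subspace_lie_span] y_in_lie_span)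
  show "lie_span (x ` {..<n}) \<subseteq> sym_map ` sym_mats n"
  proof (rule lie_span_minimal)
    show "x ` {..<n} \<subseteq> sym_map ` sym_mats n"
    proof clarify
      fix k assume "k < n"
      then have "sym_map ((1/2) \<cdot>\<^sub>m sym_unit n k k) = x k"
        using two_neq_0 by (simp add: sym_map_smult sym_map_unit y_same)
      then show "x k \<in> sym_map ` sym_mats n"
        using sym_mats_smult[OF sym_unit_sym] by (metis imageI)
    qed
    have "0\<^sub>m n n \<in> sym_mats n" "sym_map (0\<^sub>m n n) = 0"
      by (simp_all add: sym_mats_def sym_map_def)
    then have "0 \<in> sym_map ` sym_mats n" by (metis imageI)
    moreover have "sym_map S + sym_map T \<in> sym_map ` sym_mats n"
      if "S \<in> sym_mats n" "T \<in> sym_mats n" for S T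
      using that sym_map_add[of S T] sym_mats_add[of S n T] sym_matsD(1) by (metis imageI)
    moreover have "c *\<^sub>L sym_map S \<in> sym_map ` sym_mats n" if "S \<in> sym_mats n" for c S
      using that sym_map_smult[of S c] sym_mats_smult[of S n c] sym_matsD(1) by (metis imageI)
    moreover have "bracket (sym_map S) (sym_map T) \<in> sym_map ` sym_mats n"
      if "S \<in> sym_mats n" "T \<in> sym_mats n" for S T
      using that sym_map_bracket[of S T] sym_mats_path_bracket[of S n T] by (metis imageI)
    ultimately show "lie_subalgebra (sym_map ` sym_mats n)"
      unfolding lie_subalgebra_def subspace_def by blast
  qed
qed

text \<open>The kernel is known to satisfy c R c = 0. The inverse of c is passed as data since its
  existence depends on the parity of \<open>n\<close>.\<close>

lemma sym_map_inj:
  fixes C :: "'k mat"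
  assumes C: "C \<in> carrier_mat n n" "C * path_mat n = 1\<^sub>m n" "path_mat n * C = 1\<^sub>m n"
  shows "inj_on sym_map (sym_mats n)"
proof
  fix S T assume S: "S \<in> sym_mats n" and T: "T \<in> sym_mats n" and eq: "sym_map S = sym_map T"
  define R where "R = S + (-1) \<cdot>\<^sub>m T"
  have R: "R \<in> sym_mats n" using S T by (simp add: R_def sym_mats_add sym_mats_smult)
  have Rc: "R \<in> carrier_mat n n" using sym_matsD[OF R] by simp
  have "sym_map R = 0"
    using S T eq by (simp add: R_def sym_map_add sym_map_smult sym_matsD square_mat_closed)
  then have "C * (path_mat n * (R * path_mat n)) * C = C * 0\<^sub>m n n * C"
    using kernel_trivial[OF R] by simp
  moreover have "C * (path_mat n * (R * path_mat n)) * C = (C * path_mat n) * R * (path_mat n * C)"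
    using C(1) Rc by (simp add: square_mat[where n = n])
  ultimately have "R = 0\<^sub>m n n" using C Rc by simp
  then have "R $$ (i, j) = 0" if "i < n" "j < n" for i j using that by simp
  then show "S = T" using sym_matsD(1)[OF S] sym_matsD(1)[OF T]
    by (intro eq_matI) (auto simp: R_def)
qed

end

subsection \<open>Nondegenerate alternating forms\<close>

lemma ex_inverse_mat:
  fixes A :: "'k::field mat"
  assumes "A \<in> carrier_mat n n" "det A \<noteq> 0"
  obtains A' where "A' \<in> carrier_mat n n" "A * A' = 1\<^sub>m n" "A' * A = 1\<^sub>m n"
  using det_non_zero_imp_unit[OF assms, unfolded Units_def, of "()"] by (auto simp: ring_mat_def)

lemma path_mat_mult_vec:
  assumes "v \<in> carrier_vec n" "i < n"
  shows "(path_mat n *\<^sub>v v) $ i = (if Suc i < n then v $ Suc i else 0) - (if 0 < i then v $ (i - 1) else 0)"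
proof -
  have "(path_mat n *\<^sub>v v) $ i = (\<Sum>j<n. path_form i j * v $ j)"
    using assms by (simp add: scalar_prod_def atLeast0LessThan)
  \<comment> \<open>As \<open>0 - 1 = 0\<close> on natural numbers, the guard \<open>0 < i\<close>
    keeps row 0 from acquiring a second term.\<close>
  also have "\<dots> = (\<Sum>j<n. (if j = Suc i then v $ j else 0) - (if 0 < i \<and> j = i - 1 then v $ j else 0))"
    by (rule sum.cong) (auto simp: path_form_def)
  also have "\<dots> = (if Suc i < n then v $ Suc i else 0) - (if 0 < i then v $ (i - 1) else 0)"
  proof (cases "0 < i")
    case True
    moreover have "i - 1 < n" using assms by simp
    ultimately show ?thesis by (simp add: sum_subtractf)
  qed (simp add: sum_subtractf)
  finally show ?thesis .
qed

text \<open>A kernel vector satisfies v_(i+1) = v_(i-1) with zeros beyond both ends. Row 0 starts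
  the odd entries at v_1 = 0 and they vanish upwards; the last row gives v_(n-2) = 0, and for even n
  this propagates downwards through all even entries.\<close>

lemma det_path_mat:
  assumes "even n"
  shows "det (path_mat n :: 'k::field mat) \<noteq> 0"
proof
  assume "det (path_mat n :: 'k mat) = 0"
  then obtain v :: "'k vec" where v: "v \<in> carrier_vec n" "v \<noteq> 0\<^sub>v n" "path_mat n *\<^sub>v v = 0\<^sub>v n"
    using det_0_iff_vec_prod_zero[OF path_mat_carrier] by blast
  have eq: "(if Suc i < n then v $ Suc i else 0) = (if 0 < i then v $ (i - 1) else 0)" if "i < n" for i
    using path_mat_mult_vec[OF v(1) that] v(3) that by simp
  have odd: "v $ (2 * m + 1) = 0" if "2 * m + 1 < n" for m
    using that
  proof (induction m)
    case 0
    then show ?case using eq[of 0] by simp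
  next
    case (Suc m)
    then show ?case using eq[of "2 * m + 2"] by simp
  qed
  have even: "v $ (n - 2 - 2 * m) = 0" if "2 * m + 2 \<le> n" for m
    using that
  proof (induction m)
    case 0
    then show ?case using eq[of "n - 1"] by (simp add: numeral_2_eq_2)
  next
    case (Suc m)
    let ?i = "n - 3 - 2 * m"
    have i: "?i < n" "Suc ?i < n" "0 < ?i" "Suc ?i = n - 2 - 2 * m" "?i - 1 = n - 2 - 2 * Suc m"
      using Suc.prems by auto
    have "v $ Suc ?i = v $ (?i - 1)" using eq[OF i(1)] unfolding if_P[OF i(2)] if_P[OF i(3)] .
    moreover have "v $ (n - 2 - 2 * m) = 0" using Suc by simp
    ultimately show ?case unfolding i(4,5) by metis
  qed
  have "v $ i = 0" if "i < n" for i
  proof (cases "even i")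
    case True
    obtain k l where "i = 2 * k" "n = 2 * l" using True assms by (metis evenE)
    then have "n - 2 - 2 * (l - 1 - k) = i" "2 * (l - 1 - k) + 2 \<le> n" using that by auto
    then show ?thesis using even[of "l - 1 - k"] by simp
  next
    case False
    then show ?thesis using odd[of "i div 2"] that by simp
  qed
  then show False using v by auto
qed

locale symplectic_form =
  fixes n :: nat and B :: "'k::field vec \<Rightarrow> 'k vec \<Rightarrow> 'k"
  assumes alternating: "alternating_form n B" and nondegenerate: "nondegenerate_form n B"
begin

lemma add_left: "u \<in> carrier_vec n \<Longrightarrow> v \<in> carrier_vec n \<Longrightarrow> w \<in> carrier_vec n \<Longrightarrow> B (u + v) w = B u w + B v w"
  and add_right: "u \<in> carrier_vec n \<Longrightarrow> v \<in> carrier_vec n \<Longrightarrow> w \<in> carrier_vec n \<Longrightarrow> B u (v + w) = B u v + B u w"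
  and smult_left: "u \<in> carrier_vec n \<Longrightarrow> v \<in> carrier_vec n \<Longrightarrow> B (c \<cdot>\<^sub>v u) v = c * B u v"
  and smult_right: "u \<in> carrier_vec n \<Longrightarrow> v \<in> carrier_vec n \<Longrightarrow> B u (c \<cdot>\<^sub>v v) = c * B u v"
  and self: "u \<in> carrier_vec n \<Longrightarrow> B u u = 0"
  using alternating by (auto simp: alternating_form_def bilinear_form_def)

lemma skew:
  assumes "u \<in> carrier_vec n" "v \<in> carrier_vec n"
  shows "B v u = - B u v"
proof -
  have "B (u + v) (u + v) = B u v + B v u"
    using assms add_left[of u v "u + v"] add_right[of u u v] add_right[of v u v] self[of u] self[of v]
    by simp
  then have "B v u + B u v = 0" using self[of "u + v"] assms by (simp add: add.commute)
  then show ?thesis by (simp add: eq_neg_iff_add_eq_0)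
qed

text \<open>Vectors of all lengths share one type, so a finite sum of vectors is spelled out
  entrywise.\<close>

lemma sum_right:
  fixes k :: nat
  assumes "v \<in> carrier_vec n" "\<And>i. i < k \<Longrightarrow> g i \<in> carrier_vec n"
  shows "B v (vec n (\<lambda>c. \<Sum>i<k. g i $ c)) = (\<Sum>i<k. B v (g i))"
  using assms(2)
proof (induction k)
  case 0
  have "vec n (\<lambda>c. \<Sum>i<(0::nat). g i $ c) = 0 \<cdot>\<^sub>v v" using assms(1) by auto
  then show ?case using assms(1) by (simp add: smult_right)
next
  case (Suc k)
  have "vec n (\<lambda>c. \<Sum>i<Suc k. g i $ c) = vec n (\<lambda>c. \<Sum>i<k. g i $ c) + g k"
    using Suc.prems[of k] by auto
  then show ?case using Suc assms(1) by (simp add: add_right)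
qed

lemma expand_right:
  assumes "u \<in> carrier_vec n" "v \<in> carrier_vec n"
  shows "B u v = (\<Sum>i<n. v $ i * B u (unit_vec n i))"
proof -
  have "v = vec n (\<lambda>c. \<Sum>i<n. (v $ i \<cdot>\<^sub>v unit_vec n i) $ c)"
  proof (rule eq_vecI)
    fix c assume "c < dim_vec (vec n (\<lambda>c. \<Sum>i<n. (v $ i \<cdot>\<^sub>v unit_vec n i) $ c))"
    then have c: "c < n" by simp
    have "(\<Sum>i<n. (v $ i \<cdot>\<^sub>v unit_vec n i) $ c) = (\<Sum>i<n. if i = c then v $ i else 0)"
      using c by (intro sum.cong refl) (auto simp: unit_vec_def)
    then show "v $ c = vec n (\<lambda>c. \<Sum>i<n. (v $ i \<cdot>\<^sub>v unit_vec n i) $ c) $ c" using c by simp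
  qed (use assms in auto)
  then have "B u v = B u (vec n (\<lambda>c. \<Sum>i<n. (v $ i \<cdot>\<^sub>v unit_vec n i) $ c))" by simp
  also have "\<dots> = (\<Sum>i<n. B u (v $ i \<cdot>\<^sub>v unit_vec n i))" using assms by (intro sum_right) auto
  finally show ?thesis using assms by (simp add: smult_right)
qed

section \<open>The Gram matrix and skew endomorphisms\<close>

definition gram :: "'k mat" where
  "gram = mat n n (\<lambda>(i, j). B (unit_vec n i) (unit_vec n j))"

lemma gram_carrier [simp]: "gram \<in> carrier_mat n n"
  by (simp add: gram_def)

lemma gram_dim [simp]: "dim_row gram = n" "dim_col gram = n"
  by (simp_all add: gram_def)

lemma gram_skew: "gram\<^sup>T = - gram"
proof (rule eq_matI)
  fix i j assume "i < dim_row (- gram)" "j < dim_col (- gram)"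
  then show "gram\<^sup>T $$ (i, j) = (- gram) $$ (i, j)"
    using skew[of "unit_vec n i" "unit_vec n j"] by (simp add: gram_def)
qed (simp_all add: gram_def)

lemma eq_gram:
  assumes "u \<in> carrier_vec n" "v \<in> carrier_vec n"
  shows "B u v = u \<bullet> (gram *\<^sub>v v)"
proof -
  have "B (unit_vec n i) v = (gram *\<^sub>v v) $ i" if "i < n" for i
    using that assms expand_right[of "unit_vec n i" v]
    by (simp add: gram_def scalar_prod_def atLeast0LessThan mult.commute)
  moreover have "B u v = (\<Sum>i<n. u $ i * B (unit_vec n i) v)"
    using assms expand_right[of v u] by (simp add: skew[of v] sum_negf)
  ultimately show ?thesis by (simp add: scalar_prod_def atLeast0LessThan del: index_mult_mat_vec)
qed

lemma sp_iff: "A \<in> sp n B \<longleftrightarrow> A \<in> carrier_mat n n \<and> A\<^sup>T * gram = - (gram * A)"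
proof (cases "A \<in> carrier_mat n n")
  case A: True
  have l: "B (A *\<^sub>v v) w = v \<bullet> ((A\<^sup>T * gram) *\<^sub>v w)" and r: "B v (A *\<^sub>v w) = v \<bullet> ((gram * A) *\<^sub>v w)"
    if "v \<in> carrier_vec n" "w \<in> carrier_vec n" for v w
  proof -
    have "B (A *\<^sub>v v) w = (gram *\<^sub>v w) \<bullet> (A *\<^sub>v v)"
      using A that eq_gram[of "A *\<^sub>v v" w] comm_scalar_prod[of "A *\<^sub>v v" n "gram *\<^sub>v w"]
      by (simp add: mult_mat_vec_carrier[of _ n n])
    also have "\<dots> = (A\<^sup>T *\<^sub>v (gram *\<^sub>v w)) \<bullet> v"
      using A that by (simp add: transpose_vec_mult_scalar[of A n n] mult_mat_vec_carrier[of _ n n])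
    also have "\<dots> = v \<bullet> (A\<^sup>T *\<^sub>v (gram *\<^sub>v w))"
      using A that by (intro comm_scalar_prod[of _ n]) (auto simp: mult_mat_vec_carrier[of _ n n])
    finally show "B (A *\<^sub>v v) w = v \<bullet> ((A\<^sup>T * gram) *\<^sub>v w)"
      using A that by (simp add: assoc_mult_mat_vec[of _ n n _ n])
    show "B v (A *\<^sub>v w) = v \<bullet> ((gram * A) *\<^sub>v w)"
      using A that eq_gram[of v "A *\<^sub>v w"] by (simp add: assoc_mult_mat_vec[of _ n n _ n])
  qed
  have entry: "unit_vec n i \<bullet> (M *\<^sub>v unit_vec n j) = M $$ (i, j)"
    if "M \<in> carrier_mat n n" "i < n" "j < n" for M :: "'k mat" and i j
    using that by (simp add: mult_mat_vec_carrier[of _ n n])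
  show ?thesis
  proof
    assume *: "A \<in> sp n B"
    have "A\<^sup>T * gram = - (gram * A)"
    proof (rule eq_matI)
      fix i j assume "i < dim_row (- (gram * A))" "j < dim_col (- (gram * A))"
      then have ij: "i < n" "j < n" using A by (auto simp: gram_def)
      then have "B (A *\<^sub>v unit_vec n i) (unit_vec n j) = - B (unit_vec n i) (A *\<^sub>v unit_vec n j)"
        using * by (simp add: sp_def)
      then have "(A\<^sup>T * gram) $$ (i, j) = - (gram * A) $$ (i, j)"
        using ij A by (simp add: l r entry square_mat_closed[where n = n] del: index_mult_mat)
      then show "(A\<^sup>T * gram) $$ (i, j) = (- (gram * A)) $$ (i, j)"
        using ij A by (simp del: index_mult_mat(1))
    qed (use A in auto)
    then show "A \<in> carrier_mat n n \<and> A\<^sup>T * gram = - (gram * A)" using A by simp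
  next
    assume *: "A \<in> carrier_mat n n \<and> A\<^sup>T * gram = - (gram * A)"
    have "v \<bullet> ((- (gram * A)) *\<^sub>v w) = - (v \<bullet> ((gram * A) *\<^sub>v w))"
      if "v \<in> carrier_vec n" "w \<in> carrier_vec n" for v w
      using that A by simp
    then show "A \<in> sp n B" using * by (simp add: sp_def l r)
  qed
qed (auto simp: sp_def)

section \<open>Symplectic bases and path bases\<close>

lemma ex_orthogonal:
  assumes "k < n" "\<And>i. i < k \<Longrightarrow> w i \<in> carrier_vec n"
  obtains u where "u \<in> carrier_vec n" "u \<noteq> 0\<^sub>v n" "\<And>i. i < k \<Longrightarrow> B (w i) u = 0"
proof -
  \<comment> \<open>Fewer than n linear conditions on u, padded with zero rows to a square matrix;
    it is singular because row k is zero, and a kernel vector is the required u.\<close>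
  define W where "W = mat n n (\<lambda>(i, j). if i < k then B (w i) (unit_vec n j) else 0)"
  define r where "r i = (if i < k then vec n (\<lambda>j. B (w i) (unit_vec n j)) else 0\<^sub>v n)" for i
  have "W = mat\<^sub>r n n (\<lambda>i. if i = k then 0\<^sub>v n else r i)"
    by (rule eq_matI) (auto simp: W_def r_def)
  then have "det W = 0" using det_row_0[OF assms(1), of r] by (simp add: r_def)
  moreover have "W \<in> carrier_mat n n" by (simp add: W_def)
  ultimately obtain u where u: "u \<in> carrier_vec n" "u \<noteq> 0\<^sub>v n" "W *\<^sub>v u = 0\<^sub>v n"
    using det_0_iff_vec_prod_zero by blast
  have "B (w i) u = 0" if "i < k" for i
  proof -
    have "(W *\<^sub>v u) $ i = B (w i) u"
      using that assms u(1) expand_right[of "w i" u]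
      by (simp add: W_def scalar_prod_def atLeast0LessThan mult.commute)
    then show ?thesis using u(3) that assms(1) by simp
  qed
  then show ?thesis using that u by blast
qed

text \<open>Symplectic Gram-Schmidt: take u orthogonal to the pairs found so far, then a partner v
  with B(u, v) = 1, and correct v to be orthogonal to these pairs as well.\<close>

lemma ex_symplectic_basis:
  assumes "2 * k \<le> n"
  shows "\<exists>e f. \<forall>i<k. e i \<in> carrier_vec n \<and> f i \<in> carrier_vec n \<and>
    (\<forall>j<k. B (e i) (e j) = 0 \<and> B (f i) (f j) = 0 \<and> B (e i) (f j) = (if i = j then 1 else 0))"
  using assms
proof (induction k)
  case 0
  then show ?case by simp
next
  case (Suc k)
  have "2 * k \<le> n" using Suc.prems by simp
  from Suc.IH[OF this] obtain e f where *: "\<forall>i<k. e i \<in> carrier_vec n \<and> f i \<in> carrier_vec n \<and>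
    (\<forall>j<k. B (e i) (e j) = 0 \<and> B (f i) (f j) = 0 \<and> B (e i) (f j) = (if i = j then 1 else 0))"
    by (elim exE) (rule that)
  have e: "e i \<in> carrier_vec n" and f: "f i \<in> carrier_vec n" if "i < k" for i
    using * that by blast+
  have ee: "B (e i) (e j) = 0" and ff: "B (f i) (f j) = 0"
    and ef: "B (e i) (f j) = (if i = j then 1 else 0)" if "i < k" "j < k" for i j
    using * that by blast+
  define w where "w i = (if i < k then e i else f (i - k))" for i
  obtain u where u: "u \<in> carrier_vec n" "u \<noteq> 0\<^sub>v n" and wu: "\<And>i. i < 2 * k \<Longrightarrow> B (w i) u = 0"
  proof (rule ex_orthogonal[of "2 * k" w])
    show "2 * k < n" using Suc.prems by simp
    show "w i \<in> carrier_vec n" if "i < 2 * k" for i using that e f by (simp add: w_def)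
  qed blast
  have eu: "B (e i) u = 0" if "i < k" for i using wu[of i] that by (simp add: w_def)
  have fu: "B (f i) u = 0" if "i < k" for i using wu[of "k + i"] that by (simp add: w_def)
  obtain v' where v': "v' \<in> carrier_vec n" "B u v' \<noteq> 0"
    using nondegenerate u by (auto simp: nondegenerate_form_def)
  define v where "v = (1 / B u v') \<cdot>\<^sub>v v'"
  have v: "v \<in> carrier_vec n" "B u v = 1" using v' u by (simp_all add: v_def smult_right)
  \<comment> \<open>Chosen so that B(e_i, g_i) = - B(e_i, v) and B(f_i, g_i) = - B(f_i, v). As u is
    orthogonal to every g_i, the correction preserves B(u, v) = 1.\<close>
  define g where "g i = (- B (e i) v) \<cdot>\<^sub>v f i + B (f i) v \<cdot>\<^sub>v e i" for i
  define p where "p = v + vec n (\<lambda>c. \<Sum>i<k. g i $ c)"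
  have g: "g i \<in> carrier_vec n" if "i < k" for i using e f that by (simp add: g_def)
  have p: "p \<in> carrier_vec n" using v by (simp add: p_def)
  have Bp: "B a p = B a v + (\<Sum>i<k. - B (e i) v * B a (f i) + B (f i) v * B a (e i))"
    if "a \<in> carrier_vec n" for a
  proof -
    have "B a p = B a v + (\<Sum>i<k. B a (g i))"
      using that v g by (simp add: p_def add_right sum_right)
    also have "(\<Sum>i<k. B a (g i)) = (\<Sum>i<k. - B (e i) v * B a (f i) + B (f i) v * B a (e i))"
      using that e f by (intro sum.cong refl) (simp add: g_def add_right smult_right)
    finally show ?thesis .
  qed
  have ue: "B u (e i) = 0" "B u (f i) = 0" if "i < k" for i
    using skew[of "e i" u] skew[of "f i" u] eu fu e f u that by simp_all
  have fe: "B (f i) (e j) = (if i = j then -1 else 0)" if "i < k" "j < k" for i j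
    using skew[of "e j" "f i"] ef e f that by auto
  have up: "B u p = 1" using Bp[OF u(1)] v by (simp add: ue)
  have ep: "B (e i) p = 0" if "i < k" for i
  proof -
    have "(\<Sum>j<k. - B (e j) v * B (e i) (f j) + B (f j) v * B (e i) (e j)) = (\<Sum>j<k. if j = i then - B (e j) v else 0)"
      using that by (intro sum.cong refl) (simp add: ee ef)
    then show ?thesis using Bp[OF e[OF that]] that by simp
  qed
  have fp: "B (f i) p = 0" if "i < k" for i
  proof -
    have "(\<Sum>j<k. - B (e j) v * B (f i) (f j) + B (f j) v * B (f i) (e j)) = (\<Sum>j<k. if j = i then - B (f j) v else 0)"
      using that by (intro sum.cong refl) (simp add: ff fe)
    then show ?thesis using Bp[OF f[OF that]] that by simp
  qed
  have pe: "B p (e i) = 0" "B p (f i) = 0" if "i < k" for i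
    using skew[of "e i" p] skew[of "f i" p] ep fp e f p that by simp_all
  show ?case
    by (rule exI[of _ "e(k := u)"], rule exI[of _ "f(k := p)"])
      (auto simp: less_Suc_eq e f u p ee ff ef eu ue up ep fp pe self)
qed

lemma ex_path_basis:
  assumes "even n"
  obtains v where "\<And>i. i < n \<Longrightarrow> v i \<in> carrier_vec n"
    "\<And>i j. i < n \<Longrightarrow> j < n \<Longrightarrow> B (v i) (v j) = path_form i j"
proof -
  define m where "m = n div 2"
  have n: "n = 2 * m" using assms by (simp add: m_def)
  obtain e f where ef: "\<forall>i<m. e i \<in> carrier_vec n \<and> f i \<in> carrier_vec n \<and>
    (\<forall>j<m. B (e i) (e j) = 0 \<and> B (f i) (f j) = 0 \<and> B (e i) (f j) = (if i = j then 1 else 0))"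
    using ex_symplectic_basis[of m] n by auto
  \<comment> \<open>With v_(2b+1) = f_b and v_(2a) = e_a - e_(a-1), the pairing of v_(2a) with f_b
    is 1 for b = a and -1 for b = a - 1, exactly the two neighbours on the path; v_0 = e_0 has only
    the upper one.\<close>
  define v where "v i = (if odd i then f (i div 2) else
    if i = 0 then e 0 else e (i div 2) + (-1) \<cdot>\<^sub>v e (i div 2 - 1))" for i
  have lt: "i div 2 < m" "i div 2 - 1 < m" "0 < m" if "i < n" for i using that n by auto
  have car: "v i \<in> carrier_vec n" if "i < n" for i
    using ef lt[OF that] by (simp add: v_def)
  have up: "B (v i) (v j) = path_form i j" if ij: "i < n" "j < n" "even i" for i j
  proof (cases "even j")
    case True
    have "path_form i j = (0::'k)" using that True by (auto simp: path_form_def)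
    moreover have "B (v i) (v j) = 0" using ef lt[OF ij(1)] lt[OF ij(2)] ij(3) True
      by (simp add: v_def add_left add_right smult_left smult_right)
    ultimately show ?thesis by simp
  next
    case False
    obtain a b where ab: "i = 2 * a" "j = 2 * b + 1" using ij(3) False by (metis evenE oddE)
    show ?thesis using ef lt[OF ij(1)] lt[OF ij(2)] unfolding ab
      by (cases a) (auto simp: v_def add_left smult_left path_form_def)
  qed
  have "B (v i) (v j) = path_form i j" if ij: "i < n" "j < n" for i j
  proof (cases "even i \<or> even j")
    case True
    then show ?thesis using up[of i j] up[of j i] ij skew[OF car[OF ij(2)] car[OF ij(1)]]
      by (auto simp: path_form_skew[of i j])
  next
    case False
    then have "path_form i j = (0::'k)" by (auto simp: path_form_def)
    then show ?thesis using ef lt[OF ij(1)] lt[OF ij(2)] False by (simp add: v_def)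
  qed
  then show ?thesis using that car by blast
qed

lemma ex_congruence:
  assumes "even n"
  obtains P where "P \<in> carrier_mat n n" "P\<^sup>T * (gram * P) = path_mat n"
proof -
  obtain v where v: "\<And>i. i < n \<Longrightarrow> v i \<in> carrier_vec n"
    "\<And>i j. i < n \<Longrightarrow> j < n \<Longrightarrow> B (v i) (v j) = path_form i j"
    using ex_path_basis[OF assms] by blast
  define P where "P = mat n n (\<lambda>(i, j). v j $ i)"
  have P: "P \<in> carrier_mat n n" by (simp add: P_def)
  have col: "col P j = v j" if "j < n" for j
    using v(1)[OF that] that by (auto simp: P_def)
  have "P\<^sup>T * (gram * P) = path_mat n"
  proof (rule eq_matI)
    fix i j assume "i < dim_row (path_mat n :: 'k mat)" "j < dim_col (path_mat n :: 'k mat)"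
    then have ij: "i < n" "j < n" by simp_all
    have "(P\<^sup>T * (gram * P)) $$ (i, j) = row P\<^sup>T i \<bullet> col (gram * P) j"
      using ij P by simp
    also have "\<dots> = v i \<bullet> (gram *\<^sub>v v j)"
      using ij P by (simp add: col col_mult2[of _ n n])
    also have "\<dots> = path_form i j" using eq_gram v ij by metis
    finally show "(P\<^sup>T * (gram * P)) $$ (i, j) = path_mat n $$ (i, j)" using ij by simp
  qed (use P in auto)
  then show ?thesis using that P by blast
qed

text \<open>With the path basis as columns of P, the matrix P S P^T is the tensor S in standard
  coordinates, and multiplying by the Gram matrix makes it an endomorphism. Brackets match because
  P^T \<open>gram\<close> P = \<open>path_mat n\<close> appears in the middle of a product of two
  images.\<close>

lemma sym_mats_iso_sp:
  assumes "even n"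
  obtains \<Phi> where "bij_betw \<Phi> (sym_mats n) (sp n B)"
    "\<And>S T. S \<in> sym_mats n \<Longrightarrow> T \<in> sym_mats n \<Longrightarrow> \<Phi> (S + T) = \<Phi> S + \<Phi> T"
    "\<And>c S. S \<in> sym_mats n \<Longrightarrow> \<Phi> (c \<cdot>\<^sub>m S) = c \<cdot>\<^sub>m \<Phi> S"
    "\<And>S T. S \<in> sym_mats n \<Longrightarrow> T \<in> sym_mats n \<Longrightarrow> \<Phi> (path_bracket S T) = \<Phi> S * \<Phi> T - \<Phi> T * \<Phi> S"
proof -
  obtain P where P: "P \<in> carrier_mat n n" and PGP: "P\<^sup>T * (gram * P) = path_mat n"
    using ex_congruence[OF assms] .
  have "det (P\<^sup>T) * (det gram * det P) \<noteq> 0"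
    using det_path_mat[OF assms, where ?'k = 'k] P
    by (simp flip: PGP add: det_mult[of _ n] square_mat_closed[where n = n])
  then have "det P \<noteq> 0" "det gram \<noteq> 0" by auto
  then obtain P' G' where P': "P' \<in> carrier_mat n n" "P * P' = 1\<^sub>m n" "P' * P = 1\<^sub>m n"
    and G': "G' \<in> carrier_mat n n" "gram * G' = 1\<^sub>m n" "G' * gram = 1\<^sub>m n"
    using ex_inverse_mat P gram_carrier by metis
  have PT: "P\<^sup>T * P'\<^sup>T = 1\<^sub>m n" "P'\<^sup>T * P\<^sup>T = 1\<^sub>m n"
    using P P' by (simp_all flip: square_mat_smult(5))
  define \<Phi> where "\<Phi> S = P * (S * (P\<^sup>T * gram))" for S
  define \<Psi> where "\<Psi> A = P' * (A * (G' * P'\<^sup>T))" for A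
  note closed = square_mat_closed[where n = n]
  note car = P P'(1) G'(1)
  \<comment> \<open>Products are kept right-nested, so adjacent inverses meet only in front of a
    further factor X.\<close>
  have cancel: "P' * (P * X) = X" "P * (P' * X) = X" "gram * (G' * X) = X" "G' * (gram * X) = X"
    "P'\<^sup>T * (P\<^sup>T * X) = X" "P\<^sup>T * (gram * (P * X)) = path_mat n * X"
    if X: "X \<in> carrier_mat n n" for X
  proof -
    have "P' * (P * X) = (P' * P) * X" "P * (P' * X) = (P * P') * X" "gram * (G' * X) = (gram * G') * X"
      "G' * (gram * X) = (G' * gram) * X" "P'\<^sup>T * (P\<^sup>T * X) = (P'\<^sup>T * P\<^sup>T) * X"
      "P\<^sup>T * (gram * (P * X)) = (P\<^sup>T * (gram * P)) * X"
      using X car by (simp_all add: square_mat_distrib(5)[where n = n] closed)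
    then show "P' * (P * X) = X" "P * (P' * X) = X" "gram * (G' * X) = X" "G' * (gram * X) = X"
      "P'\<^sup>T * (P\<^sup>T * X) = X" "P\<^sup>T * (gram * (P * X)) = path_mat n * X"
      using X P' G' PT PGP by simp_all
  qed
  \<comment> \<open>The inverse of a skew matrix is skew; this sign cancels the one in
    \<open>AT\<close>, making \<Psi> A symmetric.\<close>
  have G'T: "G'\<^sup>T = - G'"
  proof -
    have "(gram * G')\<^sup>T = - (G'\<^sup>T * gram)"
      using G'(1) by (simp add: square_mat[where n = n] gram_skew)
    then have "- (G'\<^sup>T * gram) = 1\<^sub>m n" using G'(2) by simp
    then have "- (G'\<^sup>T * gram) * G' = G'" using G' by simp
    then have "- G'\<^sup>T = G'" using G' by (simp add: square_mat[where n = n])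
    then show ?thesis by (metis uminus_uminus_mat)
  qed
  have \<Phi>_sp: "\<Phi> S \<in> sp n B" if "S \<in> sym_mats n" for S
    using sym_matsD[OF that] P
    by (simp add: sp_iff \<Phi>_def square_mat[where n = n] gram_skew)
  have \<Psi>_sym: "\<Psi> A \<in> sym_mats n" if "A \<in> sp n B" for A
  proof -
    have A: "A \<in> carrier_mat n n" and skA: "A\<^sup>T * gram = - (gram * A)" using that by (auto simp: sp_iff)
    have "A\<^sup>T = (A\<^sup>T * gram) * G'" using A G' by (simp add: square_mat[where n = n])
    then have AT: "A\<^sup>T = - (gram * (A * G'))"
      unfolding skA using A G' by (simp add: square_mat[where n = n])
    have "(\<Psi> A)\<^sup>T = P' * (G'\<^sup>T * (A\<^sup>T * P'\<^sup>T))"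
      using A car by (simp add: \<Psi>_def square_mat[where n = n])
    also have "\<dots> = \<Psi> A"
      unfolding AT G'T \<Psi>_def using A car by (simp add: square_mat[where n = n] cancel)
    finally show ?thesis using A car by (simp add: sym_mats_def \<Psi>_def closed)
  qed
  have "\<Psi> (\<Phi> S) = S" if "S \<in> sym_mats n" for S
    using sym_matsD[OF that] car by (simp add: \<Phi>_def \<Psi>_def square_mat[where n = n] cancel PT)
  moreover have "\<Phi> (\<Psi> A) = A" if "A \<in> sp n B" for A
    using that car G' right_mult_one_mat[of A n n]
    by (simp add: sp_iff \<Phi>_def \<Psi>_def square_mat[where n = n] cancel)
  ultimately have "bij_betw \<Phi> (sym_mats n) (sp n B)"
    by (intro bij_betw_byWitness[of _ \<Psi>]) (auto simp: \<Phi>_sp \<Psi>_sym)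
  moreover have "\<Phi> (S + T) = \<Phi> S + \<Phi> T" if "S \<in> sym_mats n" "T \<in> sym_mats n" for S T
    using sym_matsD(1)[OF that(1)] sym_matsD(1)[OF that(2)] P
    by (simp add: \<Phi>_def square_mat[where n = n])
  moreover have "\<Phi> (c \<cdot>\<^sub>m S) = c \<cdot>\<^sub>m \<Phi> S" if "S \<in> sym_mats n" for c S
    using sym_matsD(1)[OF that] P by (simp add: \<Phi>_def square_mat[where n = n])
  moreover have "\<Phi> (path_bracket S T) = \<Phi> S * \<Phi> T - \<Phi> T * \<Phi> S"
    if "S \<in> sym_mats n" "T \<in> sym_mats n" for S T
    using sym_matsD(1)[OF that(1)] sym_matsD(1)[OF that(2)] P
    by (simp add: \<Phi>_def path_bracket_def square_mat[where n = n] cancel)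
  ultimately show ?thesis using that by blast
qed

end

subsection \<open>The classification\<close>

theorem theorem7p1:
  fixes scale :: "'k::alg_closed_field \<Rightarrow> 'l::ab_group_add \<Rightarrow> 'l"
    and bracket :: "'l \<Rightarrow> 'l \<Rightarrow> 'l"
    and x :: "nat \<Rightarrow> 'l"
    and n :: nat
    and B :: "'k vec \<Rightarrow> 'k vec \<Rightarrow> 'k"
  assumes "n \<ge> 2" and "even n"
    and "CHAR('k) \<noteq> 2"
    and "lie_algebra scale bracket"
    and "lie_algebra.realizes scale bracket n (path_edges n) x"
    and "\<And>i. 1 \<le> i \<Longrightarrow> i \<le> n - 1 \<Longrightarrow> lie_algebra.extremal_form scale bracket (x i) (x (i + 1)) \<noteq> 0"
    and "alternating_form n B" and "nondegenerate_form n B"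
  shows "lie_algebra.isomorphic_to_matrix_lie_algebra scale bracket
           (lie_algebra.lie_span scale bracket (x ` {1..n})) (sp n B)"
proof -
  interpret lie_algebra scale bracket by fact
  interpret symplectic_form n B using assms(7,8) by unfold_locales
  let ?L = "lie_span (x ` {1..n})"
  have ext: "extremal_in ?L (x i)" if "i \<in> {1..n}" for i
    using assms(5) that unfolding realizes_def by blast
  have L: "x i \<in> ?L" "x i \<noteq> 0" if "i \<in> {1..n}" for i
    using ext[OF that] by (auto simp: extremal_in_def)
  have edge: "bracket (x i) (x j) \<noteq> 0 \<longleftrightarrow> {i, j} \<in> path_edges n"
    if "i \<in> {1..n}" "j \<in> {1..n}" "i \<noteq> j" for i j
    using assms(5) that unfolding realizes_def by blast
  have two: "(2::'k) \<noteq> 0"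
  proof
    assume "(2::'k) = 0"
    then have "of_nat 2 = (0::'k)" by simp
    then have "CHAR('k) dvd 2" by (simp only: of_nat_eq_0_iff_char_dvd)
    then have "CHAR('k) \<le> 2" "CHAR('k) \<noteq> 0" by (auto dest: dvd_imp_le intro: ccontr)
    then show False using assms(3) CHAR_not_1[where ?'a = 'k] by linarith
  qed
  define f where "f i = extremal_form (x (Suc i)) (x (Suc (Suc i)))" for i
  have f0: "f i \<noteq> 0" if "Suc i < n" for i
    using assms(6)[of "Suc i"] that by (simp add: f_def)
  \<comment> \<open>On a path each edge introduces one new vertex, so a_i a_(i+1) f_i = 2 can be
    solved successively, by division alone.\<close>
  define a :: "nat \<Rightarrow> 'k" where "a = rec_nat 1 (\<lambda>i c. 2 / (f i * c))"
  have a_Suc: "a (Suc i) = 2 / (f i * a i)" for i by (simp add: a_def)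
  have a0: "a i \<noteq> 0" if "i < n" for i
    using that
  proof (induction i)
    case 0
    then show ?case by (simp add: a_def)
  next
    case (Suc i)
    then show ?case using f0[of i] two by (simp add: a_Suc)
  qed
  define z where "z i = scale (a i) (x (Suc i))" for i
  interpret path_generators scale bracket n z
  proof
    show "(2::'k) \<noteq> 0" "2 \<le> n" by fact+
    show "z i \<noteq> 0" if "i < n" for i
      using a0[OF that] L(2)[of "Suc i"] that by (simp add: z_def)
    show "bracket (z i) (z j) = 0" if "Suc i < j" "j < n" for i j
    proof -
      have "{Suc i, Suc j} \<notin> path_edges n"
        using that by (auto simp: path_edges_def doubleton_eq_iff)
      then show ?thesis using edge[of "Suc i" "Suc j"] that
        by (simp add: z_def bracket_scale_left bracket_scale_right)
    qed
    fix i assume i: "Suc i < n"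
    let ?u = "x (Suc i)" and ?v = "x (Suc (Suc i))"
    have mem: "Suc i \<in> {1..n}" "Suc (Suc i) \<in> {1..n}" using i by auto
    have "{Suc i, Suc (Suc i)} \<in> path_edges n" using i by (auto simp: path_edges_def)
    then have uv: "bracket ?u ?v \<noteq> 0" using edge[OF mem] by simp
    have c: "a i * a (Suc i) * f i = 2" using f0[OF i] a0[of i] i by (simp add: a_Suc)
    have up: "bracket ?u (bracket ?u ?v) = scale (f i) ?u"
      using extremal_form_eq[OF ext[OF mem(1)] L(1)[OF mem(2)]] by (simp add: f_def)
    \<comment> \<open>Symmetry of the extremal form gives both ends of the edge the same scalar, so
      one choice of a_(i+1) normalizes both relations.\<close>
    have down: "bracket ?v (bracket ?v ?u) = scale (f i) ?v"
      using extremal_form_eq[OF ext[OF mem(2)] L(1)[OF mem(1)]]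
        extremal_form_commute[OF ext[OF mem(1)] ext[OF mem(2)] uv] by (simp add: f_def)
    have "bracket (z i) (bracket (z i) (z (Suc i))) = scale (a i * a (Suc i) * f i) (z i)"
      by (simp add: z_def bracket_scale_left bracket_scale_right up mult_ac)
    then show "bracket (z i) (bracket (z i) (z (Suc i))) = scale 2 (z i)" by (simp only: c)
    have "bracket (z (Suc i)) (bracket (z (Suc i)) (z i)) = scale (a i * a (Suc i) * f i) (z (Suc i))"
      by (simp add: z_def bracket_scale_left bracket_scale_right down mult_ac)
    then show "bracket (z (Suc i)) (bracket (z (Suc i)) (z i)) = scale 2 (z (Suc i))" by (simp only: c)
  qed
  have "lie_span (z ` {..<n}) = lie_span ((\<lambda>i. x (Suc i)) ` {..<n})"
    unfolding z_def using a0 by (intro lie_span_rescale) simp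
  also have "(\<lambda>i. x (Suc i)) ` {..<n} = x ` {1..n}"
    by (simp add: image_image[symmetric, of x Suc] image_Suc_lessThan)
  finally have span: "sym_map ` sym_mats n = ?L" by (simp add: sym_map_image)
  obtain C :: "'k mat" where "C \<in> carrier_mat n n" "path_mat n * C = 1\<^sub>m n" "C * path_mat n = 1\<^sub>m n"
    using ex_inverse_mat[OF path_mat_carrier det_path_mat[OF assms(2)]] .
  then have inj: "inj_on sym_map (sym_mats n)" by (intro sym_map_inj)
  obtain \<Phi> where \<Phi>: "bij_betw \<Phi> (sym_mats n) (sp n B)"
    "\<And>S T. S \<in> sym_mats n \<Longrightarrow> T \<in> sym_mats n \<Longrightarrow> \<Phi> (S + T) = \<Phi> S + \<Phi> T"
    "\<And>c S. S \<in> sym_mats n \<Longrightarrow> \<Phi> (c \<cdot>\<^sub>m S) = c \<cdot>\<^sub>m \<Phi> S"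
    "\<And>S T. S \<in> sym_mats n \<Longrightarrow> T \<in> sym_mats n \<Longrightarrow> \<Phi> (path_bracket S T) = \<Phi> S * \<Phi> T - \<Phi> T * \<Phi> S"
    using sym_mats_iso_sp[OF assms(2)] by blast
  define \<phi> where "\<phi> = \<Phi> \<circ> inv_into (sym_mats n) sym_map"
  have \<phi>: "\<phi> (sym_map S) = \<Phi> S" if "S \<in> sym_mats n" for S
    using inv_into_f_f[OF inj that] by (simp add: \<phi>_def)
  have "bij_betw sym_map (sym_mats n) ?L"
    using inj span by (simp add: bij_betw_def)
  then have "bij_betw \<phi> ?L (sp n B)"
    unfolding \<phi>_def by (intro bij_betw_trans[OF bij_betw_inv_into \<Phi>(1)])
  moreover have "\<phi> (u + v) = \<phi> u + \<phi> v" "\<phi> (bracket u v) = \<phi> u * \<phi> v - \<phi> v * \<phi> u"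
    if uv: "u \<in> ?L" "v \<in> ?L" for u v
  proof -
    obtain S T where S: "S \<in> sym_mats n" "u = sym_map S" and T: "T \<in> sym_mats n" "v = sym_map T"
      using uv unfolding span[symmetric] by blast
    have "u + v = sym_map (S + T)" "bracket u v = sym_map (path_bracket S T)"
      using S T by (simp_all add: sym_map_add sym_map_bracket sym_matsD)
    then show "\<phi> (u + v) = \<phi> u + \<phi> v" "\<phi> (bracket u v) = \<phi> u * \<phi> v - \<phi> v * \<phi> u"
      using S T by (simp_all add: \<phi> \<Phi> sym_mats_add sym_mats_path_bracket)
  qed
  moreover have "\<phi> (scale c u) = c \<cdot>\<^sub>m \<phi> u" if u: "u \<in> ?L" for c u
  proof -
    obtain S where S: "S \<in> sym_mats n" "u = sym_map S"
      using u unfolding span[symmetric] by blast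
    have "scale c u = sym_map (c \<cdot>\<^sub>m S)" using S by (simp add: sym_map_smult sym_matsD)
    then show ?thesis using S by (simp add: \<phi> \<Phi> sym_mats_smult)
  qed
  ultimately show ?thesis unfolding isomorphic_to_matrix_lie_algebra_def by blast
qed

end
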